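(* Let $G$ be a finite group, fix $m\ge1$, let $\underline{R}$ be a $G\times\Sigma_m$-Green functor, and let $L\le G$. Then the ideal $\underline{J}(G/L)\subseteq\underline{R}\uparrow(G/L)$ is generated by $\underline{I}_{\mathrm{Tr}}(G/L)$ and the images of the transfers $$\underline{R}\Big((G\times\Sigma_m)\big/\big(\Sigma_q\wr_{\underline{n}}\Gamma(a_{S/K})\big)\Big)\xrightarrow{\ \mathrm{Tr}\ }\underline{R}(G/L)=\underline{R}\uparrow(G/L)$$ for all factorizations $m=nq$ and all subgroups $K<S\le L$ with $[S:K]=n\neq1$, where $a_{S/K}:S\to\mathrm{Aut}_{\mathrm{Set}}(S/K)\cong\Sigma_n$ is the action map by left multiplication.
   Context: For a finite group $\Gamma$, a $\Gamma$-Green functor is a $\Gamma$-Mackey functor (extended additively to all finite $\Gamma$-sets) that is levelwise a commutative ring, with restrictions ring maps and each transfer $\underline{R}(A)\to\underline{R}(B)$ a map of $\underline{R}(B)$-modules. For a $G\times\Sigma_m$-Green functor $\underline{R}$, the induced $G$-Green functor is $\underline{R}\uparrow(A)=\underline{R}(A)$, where the $G$-set $A$ is given trivial $\Sigma_m$-action. $\underline{I}_{\mathrm{Tr}}(G/L)\subseteq\underline{R}\uparrow(G/L)$ is the ideal that is the image of the transfers $\bigoplus_{i+j=m,\,i,j>0}\underline{R}((G\times\Sigma_m)/(L\times\Sigma_i\times\Sigma_j))\to\underline{R}((G\times\Sigma_m)/(L\times\Sigma_m))$. $\underline{J}(G/L)\subseteq\underline{R}\uparrow(G/L)$ is the ideal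 generated by $\underline{I}_{\mathrm{Tr}}(G/L)$ and the images of the transfers along $Z^{L,H}\hookrightarrow(G/H)^{\times_{G/L}m}\to G/L$ for all $H\le L$, where $(G/H)^{\times_{G/L}m}$ is the $m$-fold fibre product over $G/L$ ($G$ acting diagonally, $\Sigma_m$ permuting factors) and $Z^{L,H}$ is the complement of its diagonal $\Delta(G/H)$. $\Gamma(a_{S/K})\le G\times\Sigma_n$ is the graph $\{(s,a_{S/K}(s))\mid s\in S\}$, for a chosen ordering of $S/K$. For $\Lambda\le G\times\Sigma_n$, $\Sigma_q\wr_{\underline{n}}\Lambda$ is the preimage of $\Lambda$ under the canonical map $G\times(\Sigma_q\wr\Sigma_n)\to G\times\Sigma_n$; it is regarded as a subgroup of $G\times\Sigma_m$ via $\Sigma_q\wr\Sigma_n\le\Sigma_{qn}=\Sigma_m$ ($n$ blocks of size $q$). The transfer is along the map of $G\times\Sigma_m$-sets sending the coset of $(g,\sigma)$ to $gL$. *)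

theory Defs
  imports
    "HOL-Algebra.Group_Action"
    "HOL-Algebra.Left_Coset"
    "HOL-Algebra.Ideal"
    "HOL-Algebra.Sym_Groups"
begin

record ('a, 'u) gset =
  pts :: "'u set"
  act :: "'a \<Rightarrow> 'u \<Rightarrow> 'u"

definition finite_gset :: "('a, 'c) monoid_scheme \<Rightarrow> ('a, 'u) gset \<Rightarrow> bool" where
  "finite_gset G X \<longleftrightarrow> group_action G (pts X) (act X) \<and> finite (pts X)"

definition gmap ::
  "('a, 'c) monoid_scheme \<Rightarrow> ('a, 'u) gset \<Rightarrow> ('a, 'v) gset \<Rightarrow> ('u \<Rightarrow> 'v) \<Rightarrow> bool" where
  "gmap G X Y f \<longleftrightarrow>
     f \<in> pts X \<rightarrow>\<^sub>E pts Y \<and> (\<forall>g\<in>carrier G. \<forall>x\<in>pts X. f (act X g x) = act Y g (f x))"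

definition homog :: "('a, 'c) monoid_scheme \<Rightarrow> 'a set \<Rightarrow> ('a, 'a set) gset" where
  "homog G H = \<lparr>pts = lcosets\<^bsub>G\<^esub> H, act = (\<lambda>g. \<lambda>C\<in>lcosets\<^bsub>G\<^esub> H. g <#\<^bsub>G\<^esub> C)\<rparr>"

text \<open>
  A pair of functors on the category of finite \<open>G\<close>-sets whose points lie in the type \<open>'u\<close>;
  for infinite \<open>'u\<close> this category is equivalent to that of all finite \<open>G\<close>-sets.
  For a map \<open>f\<close> from \<open>X\<close> to \<open>Y\<close>, \<open>res R X Y f\<close> goes from \<open>obj R Y\<close> to \<open>obj R X\<close> and
  \<open>tr R X Y f\<close> goes from \<open>obj R X\<close> to \<open>obj R Y\<close>.
\<close>

record ('a, 'u, 'r) mackey =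
  obj :: "('a, 'u) gset \<Rightarrow> 'r ring"
  res :: "('a, 'u) gset \<Rightarrow> ('a, 'u) gset \<Rightarrow> ('u \<Rightarrow> 'u) \<Rightarrow> 'r \<Rightarrow> 'r"
  tr :: "('a, 'u) gset \<Rightarrow> ('a, 'u) gset \<Rightarrow> ('u \<Rightarrow> 'u) \<Rightarrow> 'r \<Rightarrow> 'r"

locale mackey_functor = group G
  for G :: "('a, 'c) monoid_scheme" (structure) and R :: "('a, 'u, 'r) mackey" +
  assumes finite_carrier: "finite (carrier G)"
    and obj_abelian_group: "finite_gset G X \<Longrightarrow> abelian_group (obj R X)"
    and res_additive:
      "\<lbrakk>finite_gset G X; finite_gset G Y; gmap G X Y f\<rbrakk>
        \<Longrightarrow> res R X Y f \<in> hom (add_monoid (obj R Y)) (add_monoid (obj R X))"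
    and tr_additive:
      "\<lbrakk>finite_gset G X; finite_gset G Y; gmap G X Y f\<rbrakk>
        \<Longrightarrow> tr R X Y f \<in> hom (add_monoid (obj R X)) (add_monoid (obj R Y))"
    and res_id:
      "\<lbrakk>finite_gset G X; a \<in> carrier (obj R X)\<rbrakk> \<Longrightarrow> res R X X (\<lambda>x\<in>pts X. x) a = a"
    and tr_id:
      "\<lbrakk>finite_gset G X; a \<in> carrier (obj R X)\<rbrakk> \<Longrightarrow> tr R X X (\<lambda>x\<in>pts X. x) a = a"
    and res_compose:
      "\<lbrakk>finite_gset G X; finite_gset G Y; finite_gset G Z; gmap G X Y f; gmap G Y Z h;
        c \<in> carrier (obj R Z)\<rbrakk>
        \<Longrightarrow> res R X Z (compose (pts X) h f) c = res R X Y f (res R Y Z h c)"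
    and tr_compose:
      "\<lbrakk>finite_gset G X; finite_gset G Y; finite_gset G Z; gmap G X Y f; gmap G Y Z h;
        a \<in> carrier (obj R X)\<rbrakk>
        \<Longrightarrow> tr R X Z (compose (pts X) h f) a = tr R Y Z h (tr R X Y f a)"
    and pullback:
      "\<lbrakk>finite_gset G P; finite_gset G X; finite_gset G Y; finite_gset G Z;
        gmap G P X p; gmap G P Y q; gmap G X Z f; gmap G Y Z h;
        bij_betw (\<lambda>w. (p w, q w)) (pts P) {(x, y). x \<in> pts X \<and> y \<in> pts Y \<and> f x = h y};
        a \<in> carrier (obj R X)\<rbrakk>
        \<Longrightarrow> res R Y Z h (tr R X Z f a) = tr R P Y q (res R P X p a)"
    and additivity:
      "\<lbrakk>finite_gset G X; finite_gset G Y; finite_gset G Z; gmap G X Z i; gmap G Y Z j;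
        inj_on i (pts X); inj_on j (pts Y);
        i ` pts X \<inter> j ` pts Y = {}; i ` pts X \<union> j ` pts Y = pts Z\<rbrakk>
        \<Longrightarrow> bij_betw (\<lambda>c. (res R X Z i c, res R Y Z j c))
              (carrier (obj R Z)) (carrier (obj R X) \<times> carrier (obj R Y))"

locale green_functor = mackey_functor G R
  for G :: "('a, 'c) monoid_scheme" (structure) and R :: "('a, 'u, 'r) mackey" +
  assumes obj_cring: "finite_gset G X \<Longrightarrow> cring (obj R X)"
    and res_ring_hom:
      "\<lbrakk>finite_gset G X; finite_gset G Y; gmap G X Y f\<rbrakk>
        \<Longrightarrow> res R X Y f \<in> ring_hom (obj R Y) (obj R X)"
    and frobenius:
      "\<lbrakk>finite_gset G X; finite_gset G Y; gmap G X Y f;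
        a \<in> carrier (obj R X); b \<in> carrier (obj R Y)\<rbrakk>
        \<Longrightarrow> tr R X Y f (res R X Y f b \<otimes>\<^bsub>obj R X\<^esub> a) = b \<otimes>\<^bsub>obj R Y\<^esub> tr R X Y f a"

definition triv :: "('a, 'u) gset \<Rightarrow> ('a \<times> 'b, 'u) gset" where
  "triv A = \<lparr>pts = pts A, act = (\<lambda>(g, \<sigma>). act A g)\<rparr>"

definition induced :: "('a \<times> 'b, 'u, 'r) mackey \<Rightarrow> ('a, 'u, 'r) mackey" where
  "induced R =
     \<lparr>obj = (\<lambda>A. obj R (triv A)),
      res = (\<lambda>A B f. res R (triv A) (triv B) f),
      tr = (\<lambda>A B f. tr R (triv A) (triv B) f)\<rparr>"

text \<open>
  Cosets of \<open>G\<close>, cosets of \<open>G \<times> \<Sigma>\<^sub>m\<close> and tuples of cosets of \<open>G\<close> have different types.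
  The following infinite type contains disjoint copies of all of them, and
  \<open>embed c\<close>, \<open>embed_map c d\<close> transport sets and maps along injections \<open>c\<close>, \<open>d\<close> into it.
\<close>

datatype 'g point =
    GCoset "'g set"
  | GSCoset "('g \<times> (nat \<Rightarrow> nat)) set"
  | Tuple "nat \<Rightarrow> 'g set"

definition embed :: "('v \<Rightarrow> 'u) \<Rightarrow> ('a, 'v) gset \<Rightarrow> ('a, 'u) gset" where
  "embed c X =
     \<lparr>pts = c ` pts X, act = (\<lambda>g. \<lambda>u\<in>c ` pts X. c (act X g (inv_into (pts X) c u)))\<rparr>"

definition embed_map ::
  "('v \<Rightarrow> 'u) \<Rightarrow> ('w \<Rightarrow> 'u) \<Rightarrow> ('a, 'v) gset \<Rightarrow> ('v \<Rightarrow> 'w) \<Rightarrow> 'u \<Rightarrow> 'u" where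
  "embed_map c d X f = (\<lambda>u\<in>c ` pts X. d (f (inv_into (pts X) c u)))"

definition base :: "('g, 'c) monoid_scheme \<Rightarrow> 'g set \<Rightarrow> ('g, 'g point) gset" where
  "base G L = embed GCoset (homog G L)"

definition tr_to_base ::
  "('g, 'c) monoid_scheme \<Rightarrow> ('g \<times> (nat \<Rightarrow> nat), 'g point, 'r) mackey \<Rightarrow> 'g set
   \<Rightarrow> ('v \<Rightarrow> 'g point) \<Rightarrow> ('g \<times> (nat \<Rightarrow> nat), 'v) gset \<Rightarrow> ('v \<Rightarrow> 'g set) \<Rightarrow> 'r \<Rightarrow> 'r" where
  "tr_to_base G R L c X f = tr R (embed c X) (triv (base G L)) (embed_map c GCoset X f)"

text \<open>
  For a subgroup \<open>\<Lambda>\<close> of \<open>G \<times> \<Sigma>\<^sub>m\<close> whose projection to \<open>G\<close> lies in \<open>L\<close>, the image of the coset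
  \<open>(g, \<sigma>)\<Lambda>\<close> under \<open>coset_proj\<close> is \<open>g \<cdot> fst(\<Lambda>) \<cdot> L = gL\<close>.
\<close>

definition coset_proj ::
  "('g, 'c) monoid_scheme \<Rightarrow> 'g set \<Rightarrow> ('g \<times> (nat \<Rightarrow> nat)) set \<Rightarrow> 'g set" where
  "coset_proj G L C = fst ` C <#>\<^bsub>G\<^esub> L"

definition orbit_level ::
  "('g, 'c) monoid_scheme \<Rightarrow> nat \<Rightarrow> ('g \<times> (nat \<Rightarrow> nat), 'g point, 'r) mackey
   \<Rightarrow> ('g \<times> (nat \<Rightarrow> nat)) set \<Rightarrow> 'r ring" where
  "orbit_level G m R \<Lambda> = obj R (embed GSCoset (homog (G \<times>\<times> sym_group m) \<Lambda>))"

definition orbit_tr ::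
  "('g, 'c) monoid_scheme \<Rightarrow> nat \<Rightarrow> ('g \<times> (nat \<Rightarrow> nat), 'g point, 'r) mackey \<Rightarrow> 'g set
   \<Rightarrow> ('g \<times> (nat \<Rightarrow> nat)) set \<Rightarrow> 'r \<Rightarrow> 'r" where
  "orbit_tr G m R L \<Lambda> =
     tr_to_base G R L GSCoset (homog (G \<times>\<times> sym_group m) \<Lambda>) (coset_proj G L)"

definition young :: "nat \<Rightarrow> nat \<Rightarrow> (nat \<Rightarrow> nat) set" where
  "young i j = {\<sigma> \<circ> \<tau> | \<sigma> \<tau>. \<sigma> permutes {1..i} \<and> \<tau> permutes {i + 1..i + j}}"

definition I_Tr ::
  "('g, 'c) monoid_scheme \<Rightarrow> nat \<Rightarrow> ('g \<times> (nat \<Rightarrow> nat), 'g point, 'r) mackey \<Rightarrow> 'g set \<Rightarrow> 'r set"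
  where
  "I_Tr G m R L =
     (let D = {(i, j). i + j = m \<and> 0 < i \<and> 0 < j} in
      {finsum (obj (induced R) (base G L))
          (\<lambda>(i, j). orbit_tr G m R L (L \<times> young i j) (x (i, j))) D | x.
         \<forall>(i, j)\<in>D. x (i, j) \<in> carrier (orbit_level G m R (L \<times> young i j))})"

definition fibre_power ::
  "('g, 'c) monoid_scheme \<Rightarrow> nat \<Rightarrow> 'g set \<Rightarrow> 'g set \<Rightarrow> (nat \<Rightarrow> 'g set) set" where
  "fibre_power G m L H =
     {x \<in> {1..m} \<rightarrow>\<^sub>E lcosets\<^bsub>G\<^esub> H. \<forall>i\<in>{1..m}. \<forall>j\<in>{1..m}. x i <#>\<^bsub>G\<^esub> L = x j <#>\<^bsub>G\<^esub> L}"

definition diagonal :: "('g, 'c) monoid_scheme \<Rightarrow> nat \<Rightarrow> 'g set \<Rightarrow> (nat \<Rightarrow> 'g set) set" where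
  "diagonal G m H = (\<lambda>C. \<lambda>i\<in>{1..m}. C) ` (lcosets\<^bsub>G\<^esub> H)"

definition Z_gset ::
  "('g, 'c) monoid_scheme \<Rightarrow> nat \<Rightarrow> 'g set \<Rightarrow> 'g set \<Rightarrow> ('g \<times> (nat \<Rightarrow> nat), nat \<Rightarrow> 'g set) gset"
  where
  "Z_gset G m L H =
     (let Z = fibre_power G m L H - diagonal G m H in
      \<lparr>pts = Z,
       act = (\<lambda>(g, \<sigma>). \<lambda>x\<in>Z. \<lambda>i\<in>{1..m}. g <#\<^bsub>G\<^esub> x ((inv\<^bsub>sym_group m\<^esub> \<sigma>) i))\<rparr>)"

text \<open>The common image in \<open>G/L\<close> of the entries of a tuple in the fibre product, for \<open>m \<ge> 1\<close>.\<close>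

definition fibre_proj :: "('g, 'c) monoid_scheme \<Rightarrow> 'g set \<Rightarrow> (nat \<Rightarrow> 'g set) \<Rightarrow> 'g set" where
  "fibre_proj G L x = x 1 <#>\<^bsub>G\<^esub> L"

definition J ::
  "('g, 'c) monoid_scheme \<Rightarrow> nat \<Rightarrow> ('g \<times> (nat \<Rightarrow> nat), 'g point, 'r) mackey \<Rightarrow> 'g set \<Rightarrow> 'r set"
  where
  "J G m R L =
     Idl\<^bsub>obj (induced R) (base G L)\<^esub>
       (I_Tr G m R L \<union>
        (\<Union>H\<in>{H. subgroup H G \<and> H \<subseteq> L}.
           tr_to_base G R L Tuple (Z_gset G m L H) (fibre_proj G L)
             ` carrier (obj R (embed Tuple (Z_gset G m L H)))))"

definition cosets_in :: "('g, 'c) monoid_scheme \<Rightarrow> 'g set \<Rightarrow> 'g set \<Rightarrow> 'g set set" where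
  "cosets_in G S K = lcosets\<^bsub>G\<lparr>carrier := S\<rparr>\<^esub> K"

text \<open>The action map of \<open>S\<close> on \<open>S/K\<close>, for an ordering \<open>e\<close> of \<open>S/K\<close>, i.e. a bijection from
  \<open>{1..n}\<close> to \<open>S/K\<close>.\<close>

definition action_perm ::
  "('g, 'c) monoid_scheme \<Rightarrow> nat \<Rightarrow> (nat \<Rightarrow> 'g set) \<Rightarrow> 'g \<Rightarrow> nat \<Rightarrow> nat" where
  "action_perm G n e s i = (if i \<in> {1..n} then inv_into {1..n} e (s <#\<^bsub>G\<^esub> e i) else i)"

definition graph_subgroup ::
  "('g, 'c) monoid_scheme \<Rightarrow> nat \<Rightarrow> (nat \<Rightarrow> 'g set) \<Rightarrow> 'g set \<Rightarrow> ('g \<times> (nat \<Rightarrow> nat)) set" where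
  "graph_subgroup G n e S = {(s, action_perm G n e s) | s. s \<in> S}"

text \<open>
  The element \<open>(f\<^sub>1, \<dots>, f\<^sub>n; \<tau>)\<close> of \<open>\<Sigma>\<^sub>q \<wr> \<Sigma>\<^sub>n\<close> as a permutation of \<open>{1..q * n}\<close>: the \<open>r\<close>-th element
  of block \<open>b\<close> is \<open>(b - 1) * q + r\<close>, and it is sent to element \<open>f\<^sub>b r\<close> of block \<open>\<tau> b\<close>.
\<close>

definition wreath_perm ::
  "nat \<Rightarrow> nat \<Rightarrow> (nat \<Rightarrow> nat \<Rightarrow> nat) \<Rightarrow> (nat \<Rightarrow> nat) \<Rightarrow> nat \<Rightarrow> nat" where
  "wreath_perm q n f \<tau> k =
     (if k \<in> {1..q * n}
      then let b = (k - 1) div q + 1; r = (k - 1) mod q + 1 in (\<tau> b - 1) * q + f b r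
      else k)"

definition wreath_preimage ::
  "nat \<Rightarrow> nat \<Rightarrow> ('g \<times> (nat \<Rightarrow> nat)) set \<Rightarrow> ('g \<times> (nat \<Rightarrow> nat)) set" where
  "wreath_preimage q n \<Lambda> =
     {(g, wreath_perm q n f \<tau>) | g f \<tau>. (g, \<tau>) \<in> \<Lambda> \<and> (\<forall>b\<in>{1..n}. f b permutes {1..q})}"

end

theory Submission
  imports Defs
begin

text \<open>
  A transfer to \<open>G/L\<close> out of an orbit \<open>X\<close> with base point \<open>u\<close> factors through \<open>Y \<rightarrow> G/L\<close> as soon as
  some point of \<open>Y\<close> over the image of \<open>u\<close> is fixed by the stabilizer of \<open>u\<close>, and transfers out of
  arbitrary finite sets are sums of transfers out of orbits. So only stabilizers have to be compared.

  Up to translation by \<open>G\<close>, a point of \<open>Z\<^bsup>L,H\<^esup>\<close> is a nonconstant tuple \<open>y\<close> in \<open>(L/H)\<^sup>m\<close>. Let \<open>S \<le> L\<close> be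
  the group of elements that permute the entries of \<open>y\<close> preserving multiplicities. If \<open>S\<close> is not
  transitive on the set of entries, then splitting \<open>{1..m}\<close> along an \<open>S\<close>-orbit of entries puts the
  stabilizer of \<open>y\<close> into a conjugate of \<open>L \<times> \<Sigma>\<^sub>i \<times> \<Sigma>\<^sub>j\<close>. If \<open>S\<close> is transitive, then the set of entries is
  \<open>S/K\<close>, every entry occurs equally often, say \<open>q\<close> times, and the stabilizer of \<open>y\<close> lies in a conjugate
  of \<open>\<Sigma>\<^sub>q \<wr> \<Gamma>(a\<^bsub>S/K\<^esub>)\<close>. Conversely, that wreath product fixes a point of \<open>Z\<^bsup>L,K\<^esup>\<close>.
\<close>

text \<open>Every subgroup of G x \<Sigma>_m that has to be compared is the stabilizer of a function
  t on {1..m}: coset-valued for points of Z and for wreath products, Boolean-valued with trivial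
  action (the colouring k <= i) for Young subgroups. To put the stabilizer of y into a conjugate of
  that of t, it suffices to have an equivariant relabelling F of the entries of y and a permutation
  \<sigma>0 of positions with F (y (\<sigma>0 k)) = t k. Such a \<sigma>0 exists as soon as F o y
  and t take each value equally often, so both cases reduce to counting. In the transitive case F
  sends an entry C to the set of all s in S with s y_1 = C, a coset of the stabilizer K of y_1 in S;
  and n = 1 would make y constant. The two inclusions are not symmetric. A transfer out of one orbit
  of wreath type lies in the image of one transfer out of Z^{L,K}, whereas Z^{L,H} may have many
  orbits with stabilizers of both kinds, so its transfers are only sums of elements of the
  generating images.\<close>

no_notation (ASCII) subset_mset (infix \<open><#\<close> 50)

section \<open>Transfers out of finite sets with group action\<close>

text \<open>\<open>group_action\<close> is a homomorphism into \<open>BijGroup\<close>, whose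
  elements are extensional bijections. Hence the extensionality hypothesis; bijectivity of each
  action map comes from the action of the inverse element.\<close>

lemma finite_gsetI:
  assumes "group G" and "finite (pts X)"
    and ext: "\<And>g. g \<in> carrier G \<Longrightarrow> act X g \<in> extensional (pts X)"
    and closed: "\<And>g x. \<lbrakk>g \<in> carrier G; x \<in> pts X\<rbrakk> \<Longrightarrow> act X g x \<in> pts X"
    and one: "\<And>x. x \<in> pts X \<Longrightarrow> act X \<one>\<^bsub>G\<^esub> x = x"
    and mult: "\<And>g h x. \<lbrakk>g \<in> carrier G; h \<in> carrier G; x \<in> pts X\<rbrakk>
      \<Longrightarrow> act X (g \<otimes>\<^bsub>G\<^esub> h) x = act X g (act X h x)"
  shows "finite_gset G X"
proof -
  interpret group G by fact
  have inv: "act X (inv\<^bsub>G\<^esub> g) (act X g x) = x" "act X g (act X (inv\<^bsub>G\<^esub> g) x) = x"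
    if "g \<in> carrier G" "x \<in> pts X" for g x
    using that by (simp_all flip: mult add: one)
  have bij: "act X g \<in> Bij (pts X)" if g: "g \<in> carrier G" for g
  proof -
    have "bij_betw (act X g) (pts X) (pts X)"
      by (rule bij_betw_byWitness[where f' = "act X (inv\<^bsub>G\<^esub> g)"]) (use g inv closed in auto)
    with ext[OF g] show ?thesis by (simp add: Bij_def)
  qed
  have "act X \<in> hom G (BijGroup (pts X))"
  proof (rule homI)
    fix g h assume gh: "g \<in> carrier G" "h \<in> carrier G"
    have "act X (g \<otimes>\<^bsub>G\<^esub> h) = compose (pts X) (act X g) (act X h)"
      by (rule extensionalityI[where A = "pts X"]) (use gh ext mult in \<open>auto simp: compose_eq\<close>)
    then show "act X (g \<otimes>\<^bsub>G\<^esub> h) = act X g \<otimes>\<^bsub>BijGroup (pts X)\<^esub> act X h"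
      using gh bij by (simp add: BijGroup_def)
  qed (use bij in \<open>simp add: BijGroup_def\<close>)
  then have "group_action G (pts X) (act X)"
    by (simp add: group_action_def group_hom_def group_hom_axioms_def group_BijGroup assms(1))
  with assms(2) show ?thesis by (simp add: finite_gset_def)
qed

lemma finite_gsetD:
  assumes "finite_gset G X"
  shows "group G" and "finite (pts X)"
    and "g \<in> carrier G \<Longrightarrow> act X g \<in> extensional (pts X)"
    and "\<lbrakk>g \<in> carrier G; x \<in> pts X\<rbrakk> \<Longrightarrow> act X g x \<in> pts X"
    and "x \<in> pts X \<Longrightarrow> act X \<one>\<^bsub>G\<^esub> x = x"
    and "\<lbrakk>g \<in> carrier G; h \<in> carrier G; x \<in> pts X\<rbrakk>
      \<Longrightarrow> act X (g \<otimes>\<^bsub>G\<^esub> h) x = act X g (act X h x)"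
    and "\<lbrakk>g \<in> carrier G; x \<in> pts X\<rbrakk> \<Longrightarrow> act X (inv\<^bsub>G\<^esub> g) (act X g x) = x"
proof -
  interpret group_action G "pts X" "act X" using assms by (simp add: finite_gset_def)
  show "group G" using group_hom by (simp add: group_hom_def)
  show "finite (pts X)" using assms by (simp add: finite_gset_def)
  show "g \<in> carrier G \<Longrightarrow> act X g \<in> extensional (pts X)"
    using bij_prop0 by (blast intro: Bij_imp_extensional)
  show "\<lbrakk>g \<in> carrier G; x \<in> pts X\<rbrakk> \<Longrightarrow> act X g x \<in> pts X" using element_image by blast
  show "x \<in> pts X \<Longrightarrow> act X \<one>\<^bsub>G\<^esub> x = x" by (metis id_eq_one restrict_apply')
  show "\<lbrakk>g \<in> carrier G; h \<in> carrier G; x \<in> pts X\<rbrakk>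
      \<Longrightarrow> act X (g \<otimes>\<^bsub>G\<^esub> h) x = act X g (act X h x)" by (rule composition_rule)
  show "\<lbrakk>g \<in> carrier G; x \<in> pts X\<rbrakk> \<Longrightarrow> act X (inv\<^bsub>G\<^esub> g) (act X g x) = x"
    using orbit_sym_aux by blast
qed

lemma gmapI:
  assumes "f \<in> extensional (pts X)" and "\<And>x. x \<in> pts X \<Longrightarrow> f x \<in> pts Y"
    and "\<And>g x. \<lbrakk>g \<in> carrier G; x \<in> pts X\<rbrakk> \<Longrightarrow> f (act X g x) = act Y g (f x)"
  shows "gmap G X Y f"
  using assms by (auto simp: gmap_def PiE_def)

lemma gmapD:
  assumes "gmap G X Y f"
  shows "f \<in> extensional (pts X)" and "x \<in> pts X \<Longrightarrow> f x \<in> pts Y"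
    and "\<lbrakk>g \<in> carrier G; x \<in> pts X\<rbrakk> \<Longrightarrow> f (act X g x) = act Y g (f x)"
  using assms by (auto simp: gmap_def PiE_def)

section \<open>Invariant subsets and maps out of an orbit\<close>

definition sub_gset :: "('a, 'u) gset \<Rightarrow> 'u set \<Rightarrow> ('a, 'u) gset" where
  "sub_gset X A = \<lparr>pts = A, act = (\<lambda>g. restrict (act X g) A)\<rparr>"

lemma pts_sub_gset [simp]: "pts (sub_gset X A) = A"
  and act_sub_gset: "act (sub_gset X A) g = restrict (act X g) A"
  by (simp_all add: sub_gset_def)

lemma sub_gset_sub_gset: "B \<subseteq> A \<Longrightarrow> sub_gset (sub_gset X A) B = sub_gset X B"
  by (auto simp: sub_gset_def fun_eq_iff)

lemma finite_gset_sub_gset: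
  assumes "finite_gset G X" and "A \<subseteq> pts X"
    and "\<And>g x. \<lbrakk>g \<in> carrier G; x \<in> A\<rbrakk> \<Longrightarrow> act X g x \<in> A"
  shows "finite_gset G (sub_gset X A)"
proof -
  note X = finite_gsetD[OF assms(1)]
  have "monoid G" using X(1) by (simp add: group_def)
  then show ?thesis
    by (intro finite_gsetI)
      (use X assms(2,3) in \<open>auto simp: act_sub_gset subset_iff monoid.m_closed intro: finite_subset\<close>)
qed

lemma gmap_restrict:
  assumes "gmap G X Y f" and "A \<subseteq> pts X"
    and "\<And>g x. \<lbrakk>g \<in> carrier G; x \<in> A\<rbrakk> \<Longrightarrow> act X g x \<in> A"
  shows "gmap G (sub_gset X A) Y (restrict f A)"
  by (rule gmapI) (use assms gmapD[OF assms(1)] in \<open>auto simp: act_sub_gset subset_iff\<close>)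

lemma gmap_inclusion:
  assumes "finite_gset G X" and "A \<subseteq> pts X"
    and "\<And>g x. \<lbrakk>g \<in> carrier G; x \<in> A\<rbrakk> \<Longrightarrow> act X g x \<in> A"
  shows "gmap G (sub_gset X A) X (\<lambda>x\<in>A. x)"
  by (rule gmapI) (use assms in \<open>auto simp: act_sub_gset subset_iff\<close>)

lemma gmap_id: "finite_gset G X \<Longrightarrow> gmap G X X (\<lambda>x\<in>pts X. x)"
  by (rule gmapI) (auto dest: finite_gsetD)

text \<open>The map g u \<mapsto> g w is well defined: g u = h u puts h^-1 g into the stabilizer of
  u, which fixes w.\<close>

lemma gmap_from_orbit:
  assumes X: "finite_gset G X" and Y: "finite_gset G Y" and u: "u \<in> pts X" and w: "w \<in> pts Y"
    and orb: "pts X = (\<lambda>g. act X g u) ` carrier G"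
    and stab: "\<And>g. \<lbrakk>g \<in> carrier G; act X g u = u\<rbrakk> \<Longrightarrow> act Y g w = w"
  obtains f where "gmap G X Y f" and "f u = w"
proof -
  interpret group G using X by (rule finite_gsetD)
  note X' = finite_gsetD[OF X] and Y' = finite_gsetD[OF Y]
  have eq: "act Y g w = act Y h w"
    if g: "g \<in> carrier G" and h: "h \<in> carrier G" and "act X g u = act X h u" for g h
  proof -
    have "act X (inv\<^bsub>G\<^esub> h \<otimes>\<^bsub>G\<^esub> g) u = u" using that u X'(6,7) by simp
    then have "act Y (inv\<^bsub>G\<^esub> h \<otimes>\<^bsub>G\<^esub> g) w = w" using g h stab by simp
    then have "act Y h w = act Y h (act Y (inv\<^bsub>G\<^esub> h \<otimes>\<^bsub>G\<^esub> g) w)" by simp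
    also have "\<dots> = act Y (h \<otimes>\<^bsub>G\<^esub> (inv\<^bsub>G\<^esub> h \<otimes>\<^bsub>G\<^esub> g)) w"
      using g h w by (intro Y'(6)[symmetric]) auto
    also have "\<dots> = act Y g w" using g h by (simp flip: m_assoc)
    finally show ?thesis by simp
  qed
  define f where "f = (\<lambda>x\<in>pts X. act Y (SOME g. g \<in> carrier G \<and> act X g u = x) w)"
  have f: "f (act X g u) = act Y g w" if g: "g \<in> carrier G" for g
  proof -
    have "\<exists>h. h \<in> carrier G \<and> act X h u = act X g u" using g by blast
    from someI_ex[OF this] show ?thesis using g u X'(4) by (auto simp: f_def intro: eq)
  qed
  have "gmap G X Y f"
  proof (rule gmapI)
    show "f x \<in> pts Y" if "x \<in> pts X" for x
      using that f Y'(4)[OF _ w] unfolding orb by auto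
    show "f (act X g x) = act Y g (f x)" if g: "g \<in> carrier G" and "x \<in> pts X" for g x
    proof -
      obtain h where h: "h \<in> carrier G" "x = act X h u" using \<open>x \<in> pts X\<close> unfolding orb by blast
      then have "f (act X g x) = f (act X (g \<otimes>\<^bsub>G\<^esub> h) u)" using g u X'(6) by simp
      then show ?thesis using g h w Y'(6) by (simp add: f)
    qed
  qed (simp add: f_def)
  moreover have "f u = w" using f[of "\<one>\<^bsub>G\<^esub>"] X'(5)[OF u] Y'(5)[OF w] by simp
  ultimately show ?thesis by (rule that)
qed

lemma gmap_orbit_eqI:
  assumes "gmap G X Y f" and "gmap G X Y f'" and u: "u \<in> pts X"
    and orb: "pts X = (\<lambda>g. act X g u) ` carrier G" and "f u = f' u"
  shows "f = f'"
proof (rule extensionalityI[of _ "pts X"])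
  fix x assume "x \<in> pts X"
  then obtain g where "g \<in> carrier G" "x = act X g u" unfolding orb by blast
  then show "f x = f' x" using assms gmapD(3)[OF assms(1)] gmapD(3)[OF assms(2)] by simp
qed (use assms gmapD in blast)+

section \<open>Additivity and the reduction of transfers to orbits\<close>

context mackey_functor
begin

lemma tr_closed:
  "\<lbrakk>finite_gset G X; finite_gset G Y; gmap G X Y f; a \<in> carrier (obj R X)\<rbrakk>
    \<Longrightarrow> tr R X Y f a \<in> carrier (obj R Y)"
  using tr_additive[of X Y f] by (auto simp: hom_def)

lemma res_closed:
  "\<lbrakk>finite_gset G X; finite_gset G Y; gmap G X Y f; b \<in> carrier (obj R Y)\<rbrakk>
    \<Longrightarrow> res R X Y f b \<in> carrier (obj R X)"
  using res_additive[of X Y f] by (auto simp: hom_def)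

lemma tr_add:
  "\<lbrakk>finite_gset G X; finite_gset G Y; gmap G X Y f; a \<in> carrier (obj R X); b \<in> carrier (obj R X)\<rbrakk>
    \<Longrightarrow> tr R X Y f (a \<oplus>\<^bsub>obj R X\<^esub> b) = tr R X Y f a \<oplus>\<^bsub>obj R Y\<^esub> tr R X Y f b"
  using tr_additive[of X Y f] by (auto simp: hom_def)

lemma res_add:
  "\<lbrakk>finite_gset G X; finite_gset G Y; gmap G X Y f; a \<in> carrier (obj R Y); b \<in> carrier (obj R Y)\<rbrakk>
    \<Longrightarrow> res R X Y f (a \<oplus>\<^bsub>obj R Y\<^esub> b) = res R X Y f a \<oplus>\<^bsub>obj R X\<^esub> res R X Y f b"
  using res_additive[of X Y f] by (auto simp: hom_def)

lemma tr_zero: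
  assumes "finite_gset G X" and "finite_gset G Y" and "gmap G X Y f"
  shows "tr R X Y f \<zero>\<^bsub>obj R X\<^esub> = \<zero>\<^bsub>obj R Y\<^esub>"
proof -
  interpret X: abelian_group "obj R X" by (rule obj_abelian_group) fact
  interpret Y: abelian_group "obj R Y" by (rule obj_abelian_group) fact
  show ?thesis using hom_one[OF tr_additive[OF assms] X.a_group Y.a_group] by simp
qed

text \<open>The empty set is the disjoint union of two copies of itself. Additivity therefore makes
  a map of the form c \<mapsto> (r c, r c) surjective onto the square of the group, and a value (a,
  0) forces a = 0.\<close>

lemma obj_empty:
  assumes "finite_gset G X" and "pts X = {}" and "a \<in> carrier (obj R X)"
  shows "a = \<zero>\<^bsub>obj R X\<^esub>"
proof -
  interpret X: abelian_group "obj R X" by (rule obj_abelian_group) fact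
  let ?i = "\<lambda>x\<in>pts X. x"
  have "bij_betw (\<lambda>c. (res R X X ?i c, res R X X ?i c))
      (carrier (obj R X)) (carrier (obj R X) \<times> carrier (obj R X))"
    by (rule additivity) (use assms gmap_id[of G X] in auto)
  then have "(a, \<zero>\<^bsub>obj R X\<^esub>) \<in> (\<lambda>c. (res R X X ?i c, res R X X ?i c)) ` carrier (obj R X)"
    using assms by (simp add: bij_betw_def)
  then show ?thesis by auto
qed

text \<open>The pullback of an injection along itself is its source with identity legs, so the base
  change formula reduces to identities.\<close>

lemma res_tr_inclusion:
  assumes X: "finite_gset G X" and A: "A \<subseteq> pts X"
    and inv: "\<And>g x. \<lbrakk>g \<in> carrier G; x \<in> A\<rbrakk> \<Longrightarrow> act X g x \<in> A"
    and a: "a \<in> carrier (obj R (sub_gset X A))"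
  shows "res R (sub_gset X A) X (\<lambda>x\<in>A. x) (tr R (sub_gset X A) X (\<lambda>x\<in>A. x) a) = a"
proof -
  let ?A = "sub_gset X A" and ?i = "\<lambda>x\<in>A. x"
  have fA: "finite_gset G ?A" by (rule finite_gset_sub_gset) fact+
  have i: "gmap G ?A X ?i" by (rule gmap_inclusion) fact+
  have id: "gmap G ?A ?A ?i" using gmap_id[OF fA] by simp
  have "res R ?A X ?i (tr R ?A X ?i a) = tr R ?A ?A ?i (res R ?A ?A ?i a)"
    by (rule pullback[OF fA fA fA X id id i i _ a]) (use A in \<open>auto simp: bij_betw_def inj_on_def\<close>)
  then show ?thesis using res_id[OF fA a] tr_id[OF fA a] by simp
qed

text \<open>The pullback of two inclusions with disjoint images is empty, so base change factors
  through the zero group over the empty set.\<close>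

lemma res_tr_disjoint:
  assumes X: "finite_gset G X" and A: "A \<subseteq> pts X" and B: "B \<subseteq> pts X" and "A \<inter> B = {}"
    and invA: "\<And>g x. \<lbrakk>g \<in> carrier G; x \<in> A\<rbrakk> \<Longrightarrow> act X g x \<in> A"
    and invB: "\<And>g x. \<lbrakk>g \<in> carrier G; x \<in> B\<rbrakk> \<Longrightarrow> act X g x \<in> B"
    and a: "a \<in> carrier (obj R (sub_gset X A))"
  shows "res R (sub_gset X B) X (\<lambda>x\<in>B. x) (tr R (sub_gset X A) X (\<lambda>x\<in>A. x) a)
    = \<zero>\<^bsub>obj R (sub_gset X B)\<^esub>"
proof -
  let ?A = "sub_gset X A" and ?B = "sub_gset X B" and ?E = "sub_gset X {}"
  have fA: "finite_gset G ?A" by (rule finite_gset_sub_gset) fact+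
  have fB: "finite_gset G ?B" by (rule finite_gset_sub_gset) fact+
  have fE: "finite_gset G ?E" by (rule finite_gset_sub_gset[OF X]) auto
  have i: "gmap G ?A X (\<lambda>x\<in>A. x)" by (rule gmap_inclusion) fact+
  have j: "gmap G ?B X (\<lambda>x\<in>B. x)" by (rule gmap_inclusion) fact+
  \<comment> \<open>The only extensional function on the empty set.\<close>
  define p :: "'u \<Rightarrow> 'u" where "p = (\<lambda>x. undefined)"
  have pA: "gmap G ?E ?A p" and pB: "gmap G ?E ?B p" by (auto intro!: gmapI simp: p_def)
  have "res R ?B X (\<lambda>x\<in>B. x) (tr R ?A X (\<lambda>x\<in>A. x) a) = tr R ?E ?B p (res R ?E ?A p a)"
    by (rule pullback[OF fE fA fB X pA pB i j _ a])
      (use \<open>A \<inter> B = {}\<close> in \<open>auto simp: bij_betw_def\<close>)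
  also have "res R ?E ?A p a = \<zero>\<^bsub>obj R ?E\<^esub>"
    by (rule obj_empty[OF fE _ res_closed[OF fE fA pA a]]) simp
  also note tr_zero[OF fE fB pB]
  finally show ?thesis .
qed

text \<open>Additivity makes the pair of restrictions to A and B injective, and by
  \<open>res_tr_inclusion\<close> and \<open>res_tr_disjoint\<close> both sides of the equation have
  the same pair of restrictions.\<close>

lemma tr_res_decomposition:
  assumes X: "finite_gset G X" and A: "A \<subseteq> pts X" and B: "B = pts X - A"
    and invA: "\<And>g x. \<lbrakk>g \<in> carrier G; x \<in> A\<rbrakk> \<Longrightarrow> act X g x \<in> A"
    and invB: "\<And>g x. \<lbrakk>g \<in> carrier G; x \<in> B\<rbrakk> \<Longrightarrow> act X g x \<in> B"
    and a: "a \<in> carrier (obj R X)"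
  shows "a = tr R (sub_gset X A) X (\<lambda>x\<in>A. x) (res R (sub_gset X A) X (\<lambda>x\<in>A. x) a)
    \<oplus>\<^bsub>obj R X\<^esub> tr R (sub_gset X B) X (\<lambda>x\<in>B. x) (res R (sub_gset X B) X (\<lambda>x\<in>B. x) a)"
    (is "a = ?b")
proof -
  let ?A = "sub_gset X A" and ?B = "sub_gset X B" and ?i = "\<lambda>x\<in>A. x" and ?j = "\<lambda>x\<in>B. x"
  have B': "B \<subseteq> pts X" and dis: "A \<inter> B = {}" "B \<inter> A = {}" using B by auto
  have fA: "finite_gset G ?A" by (rule finite_gset_sub_gset) fact+
  have fB: "finite_gset G ?B" by (rule finite_gset_sub_gset) fact+
  have i: "gmap G ?A X ?i" by (rule gmap_inclusion) fact+
  have j: "gmap G ?B X ?j" by (rule gmap_inclusion) fact+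
  interpret X: abelian_group "obj R X" by (rule obj_abelian_group) fact
  interpret A: abelian_group "obj R ?A" by (rule obj_abelian_group) fact
  interpret B: abelian_group "obj R ?B" by (rule obj_abelian_group) fact
  note cA = res_closed[OF fA X i a] and cB = res_closed[OF fB X j a]
  note tA = tr_closed[OF fA X i cA] and tB = tr_closed[OF fB X j cB]
  have "inj_on (\<lambda>c. (res R ?A X ?i c, res R ?B X ?j c)) (carrier (obj R X))"
    by (rule bij_betw_imp_inj_on, rule additivity[OF fA fB X i j])
      (use A B in \<open>auto simp: inj_on_def\<close>)
  moreover have "res R ?A X ?i ?b = res R ?A X ?i a"
    using res_add[OF fA X i tA tB] res_tr_inclusion[OF X A invA cA]
      res_tr_disjoint[OF X B' A dis(2) invB invA cB] cA by simp
  moreover have "res R ?B X ?j ?b = res R ?B X ?j a"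
    using res_add[OF fB X j tA tB] res_tr_inclusion[OF X B' invB cB]
      res_tr_disjoint[OF X A B' dis(1) invA invB cA] cB by simp
  ultimately show ?thesis using tA tB a by (auto dest: inj_onD)
qed

lemma tr_image_subset_factor:
  assumes "finite_gset G X" and "finite_gset G Y" and "finite_gset G B"
    and "gmap G X Y f" and "gmap G Y B h"
  shows "tr R X B (compose (pts X) h f) ` carrier (obj R X) \<subseteq> tr R Y B h ` carrier (obj R Y)"
  using tr_compose[OF assms] tr_closed[OF assms(1,2,4)] by auto

text \<open>The map X \<rightarrow> Y with u \<mapsto> w composes with h to an equivariant map that
  agrees with p at u, hence on the whole orbit; functoriality of transfers then gives the
  inclusion.\<close>

lemma tr_orbit_subset:
  assumes X: "finite_gset G X" and Y: "finite_gset G Y" and B: "finite_gset G B"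
    and p: "gmap G X B p" and h: "gmap G Y B h"
    and u: "u \<in> pts X" and orb: "pts X = (\<lambda>g. act X g u) ` carrier G"
    and w: "w \<in> pts Y" and "h w = p u"
    and stab: "\<And>g. \<lbrakk>g \<in> carrier G; act X g u = u\<rbrakk> \<Longrightarrow> act Y g w = w"
  shows "tr R X B p ` carrier (obj R X) \<subseteq> tr R Y B h ` carrier (obj R Y)"
proof -
  obtain f where f: "gmap G X Y f" "f u = w" by (rule gmap_from_orbit[OF X Y u w orb stab])
  have "gmap G X B (compose (pts X) h f)"
    by (rule gmapI) (use f h in \<open>auto simp: compose_eq gmapD finite_gsetD[OF X]\<close>)
  then have "compose (pts X) h f = p"
    by (rule gmap_orbit_eqI[OF _ p u orb]) (use f u \<open>h w = p u\<close> in \<open>simp add: compose_eq\<close>)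
  with tr_image_subset_factor[OF X Y B f(1) h] show ?thesis by simp
qed

lemma orbit_closed:
  assumes "finite_gset G X" and "x \<in> pts X" and "g \<in> carrier G" and "y \<in> orbit G (act X) x"
  shows "act X g y \<in> orbit G (act X) x"
proof -
  obtain h where "h \<in> carrier G" "y = act X h x" using assms(4) by (auto simp: orbit_def)
  then have "act X g y = act X (g \<otimes> h) x" "g \<otimes> h \<in> carrier G"
    using assms finite_gsetD(6)[OF assms(1)] by simp_all
  then show ?thesis by (auto simp: orbit_def)
qed

text \<open>Induction on the number of points: one orbit A is split off, and the orbits in its
  invariant complement are orbits of X, so the hypothesis passes to the smaller set. I is a set with
  zero that is closed under sums, so that an ideal can be inserted later.\<close>

lemma tr_in_if_orbits:
  assumes "finite_gset G X" and B: "finite_gset G B" and "gmap G X B p"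
    and zero: "\<zero>\<^bsub>obj R B\<^esub> \<in> I" and add: "\<And>a b. \<lbrakk>a \<in> I; b \<in> I\<rbrakk> \<Longrightarrow> a \<oplus>\<^bsub>obj R B\<^esub> b \<in> I"
    and "\<And>x. x \<in> pts X \<Longrightarrow>
      tr R (sub_gset X (orbit G (act X) x)) B (restrict p (orbit G (act X) x))
        ` carrier (obj R (sub_gset X (orbit G (act X) x))) \<subseteq> I"
    and "a \<in> carrier (obj R X)"
  shows "tr R X B p a \<in> I"
  using assms(1,3,6,7)
proof (induction "card (pts X)" arbitrary: X p a rule: less_induct)
  case less
  note X = less.prems(1) and p = less.prems(2) and orb = less.prems(3) and a = less.prems(4)
  note X' = finite_gsetD[OF X]
  show ?case
  proof (cases "pts X = {}")
    case True
    then have "a = \<zero>\<^bsub>obj R X\<^esub>" using X a by (simp add: obj_empty)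
    then show ?thesis using tr_zero[OF X B p] zero by simp
  next
    case False
    then obtain x where x: "x \<in> pts X" by blast
    define A C where "A = orbit G (act X) x" and "C = pts X - A"
    have A: "A \<subseteq> pts X" using x X'(4) by (auto simp: A_def orbit_def)
    have C: "C \<subseteq> pts X" by (auto simp: C_def)
    have "x \<in> A" using X'(5)[OF x] by (force simp: A_def orbit_def)
    have invA: "act X g y \<in> A" if "g \<in> carrier G" "y \<in> A" for g y
      using that orbit_closed[OF X x] by (simp add: A_def)
    \<comment> \<open>If g y were in A, then so would be y, by acting with the inverse of g.\<close>
    have invC: "act X g y \<in> C" if "g \<in> carrier G" "y \<in> C" for g y
      using that invA[of "inv g" "act X g y"] X'(4,7) by (auto simp: C_def)
    let ?A = "sub_gset X A" and ?C = "sub_gset X C"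
    have fA: "finite_gset G ?A" by (rule finite_gset_sub_gset) fact+
    have fC: "finite_gset G ?C" by (rule finite_gset_sub_gset) fact+
    have i: "gmap G ?A X (\<lambda>x\<in>A. x)" by (rule gmap_inclusion) fact+
    have j: "gmap G ?C X (\<lambda>x\<in>C. x)" by (rule gmap_inclusion) fact+
    have pC: "gmap G ?C B (restrict p C)" by (rule gmap_restrict) fact+
    have comp: "compose A p (\<lambda>x\<in>A. x) = restrict p A" "compose C p (\<lambda>x\<in>C. x) = restrict p C"
      by (auto simp: compose_def restrict_def)
    define b c where "b = res R ?A X (\<lambda>x\<in>A. x) a" and "c = res R ?C X (\<lambda>x\<in>C. x) a"
    have b: "b \<in> carrier (obj R ?A)" unfolding b_def by (rule res_closed[OF fA X i a])
    have c: "c \<in> carrier (obj R ?C)" unfolding c_def by (rule res_closed[OF fC X j a])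
    have "a = tr R ?A X (\<lambda>x\<in>A. x) b \<oplus>\<^bsub>obj R X\<^esub> tr R ?C X (\<lambda>x\<in>C. x) c"
      unfolding b_def c_def by (rule tr_res_decomposition[OF X A C_def invA invC a])
    then have "tr R X B p a = tr R X B p (tr R ?A X (\<lambda>x\<in>A. x) b) \<oplus>\<^bsub>obj R B\<^esub>
        tr R X B p (tr R ?C X (\<lambda>x\<in>C. x) c)"
      using tr_add[OF X B p tr_closed[OF fA X i b] tr_closed[OF fC X j c]] by simp
    also have "\<dots> = tr R ?A B (restrict p A) b \<oplus>\<^bsub>obj R B\<^esub> tr R ?C B (restrict p C) c"
      using tr_compose[OF fA X B i p b] tr_compose[OF fC X B j p c] by (simp add: comp)
    also have "\<dots> \<in> I"
    proof (rule add)
      show "tr R ?A B (restrict p A) b \<in> I" using orb[OF x] b by (auto simp: A_def)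
      show "tr R ?C B (restrict p C) c \<in> I"
      proof (rule less.hyps[OF _ fC pC _ c])
        have "C \<subset> pts X" using x \<open>x \<in> A\<close> by (auto simp: C_def)
        then show "card (pts ?C) < card (pts X)" by (simp add: psubset_card_mono X'(2))
        fix y assume "y \<in> pts ?C"
        then have y: "y \<in> C" by simp
        have O: "orbit G (act ?C) y = orbit G (act X) y"
          using y by (simp add: orbit_def act_sub_gset)
        have OC: "orbit G (act X) y \<subseteq> C" using y invC by (auto simp: orbit_def)
        have "restrict (restrict p C) (orbit G (act X) y) = restrict p (orbit G (act X) y)"
          using OC by (auto simp: restrict_def fun_eq_iff)
        then show "tr R (sub_gset ?C (orbit G (act ?C) y)) B
            (restrict (restrict p C) (orbit G (act ?C) y))
              ` carrier (obj R (sub_gset ?C (orbit G (act ?C) y))) \<subseteq> I"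
          using orb[of y] y C OC by (auto simp: O sub_gset_sub_gset)
      qed
    qed
    finally show ?thesis .
  qed
qed

text \<open>Each orbit may be tested at any base point k x of it. This freedom later allows a tuple
  to be moved by G until its entries lie in L.\<close>

lemma tr_image_subset_if_stabilizers:
  assumes X: "finite_gset G X" and B: "finite_gset G B" and p: "gmap G X B p"
    and zero: "\<zero>\<^bsub>obj R B\<^esub> \<in> I" and add: "\<And>a b. \<lbrakk>a \<in> I; b \<in> I\<rbrakk> \<Longrightarrow> a \<oplus>\<^bsub>obj R B\<^esub> b \<in> I"
    and ex: "\<And>x. x \<in> pts X \<Longrightarrow> \<exists>k\<in>carrier G. \<exists>Y h. \<exists>w\<in>pts Y. finite_gset G Y \<and> gmap G Y B h \<and>
      h w = p (act X k x) \<and> tr R Y B h ` carrier (obj R Y) \<subseteq> I \<and>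
      (\<forall>g\<in>carrier G. act X g (act X k x) = act X k x \<longrightarrow> act Y g w = w)"
  shows "tr R X B p ` carrier (obj R X) \<subseteq> I"
proof (rule image_subsetI, rule tr_in_if_orbits[OF X B p zero])
  fix x assume x: "x \<in> pts X"
  note X' = finite_gsetD[OF X]
  let ?O = "orbit G (act X) x"
  obtain k Y h w where k: "k \<in> carrier G" and w: "w \<in> pts Y" and Y: "finite_gset G Y"
    and h: "gmap G Y B h" and hw: "h w = p (act X k x)"
    and I: "tr R Y B h ` carrier (obj R Y) \<subseteq> I"
    and stab: "\<forall>g\<in>carrier G. act X g (act X k x) = act X k x \<longrightarrow> act Y g w = w"
    using ex[OF x] by (elim bexE exE conjE) (rule that)
  have O: "?O \<subseteq> pts X" using x X'(4) by (auto simp: orbit_def)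
  have u: "act X k x \<in> ?O" using k by (auto simp: orbit_def)
  have "tr R (sub_gset X ?O) B (restrict p ?O) ` carrier (obj R (sub_gset X ?O))
      \<subseteq> tr R Y B h ` carrier (obj R Y)"
  proof (rule tr_orbit_subset[OF _ Y B _ h _ _ w])
    show "finite_gset G (sub_gset X ?O)"
      by (rule finite_gset_sub_gset[OF X O orbit_closed[OF X x]])
    show "gmap G (sub_gset X ?O) B (restrict p ?O)"
      by (rule gmap_restrict[OF p O orbit_closed[OF X x]])
    show "act X k x \<in> pts (sub_gset X ?O)" using u by simp
    show "pts (sub_gset X ?O) = (\<lambda>g. act (sub_gset X ?O) g (act X k x)) ` carrier G"
    proof -
      have "?O = (\<lambda>g. act X g (act X k x)) ` carrier G"
      proof (intro equalityI subsetI)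
        fix y assume "y \<in> ?O"
        then obtain g where g: "g \<in> carrier G" and y: "y = act X g x" by (auto simp: orbit_def)
        then have "y = act X (g \<otimes> inv k \<otimes> k) x" using k by (simp add: m_assoc)
        also have "\<dots> = act X (g \<otimes> inv k) (act X k x)" using g k x by (intro X'(6)) auto
        finally show "y \<in> (\<lambda>g. act X g (act X k x)) ` carrier G" using g k by blast
      qed (use orbit_closed[OF X x _ u] in blast)
      then show ?thesis using u by (simp add: act_sub_gset)
    qed
    show "h w = restrict p ?O (act X k x)" using hw u by simp
    show "act Y g w = w"
      if "g \<in> carrier G" "act (sub_gset X ?O) g (act X k x) = act X k x" for g
      using that stab u by (simp add: act_sub_gset)
  qed
  with I show "tr R (sub_gset X ?O) B (restrict p ?O) ` carrier (obj R (sub_gset X ?O)) \<subseteq> I"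
    by blast
qed (rule add)

end

section \<open>Homogeneous sets and fibre powers\<close>

lemma pts_embed [simp]: "pts (embed c X) = c ` pts X"
  by (simp add: embed_def)

lemma act_embed:
  assumes "inj_on c (pts X)" and "x \<in> pts X"
  shows "act (embed c X) g (c x) = c (act X g x)"
  using assms by (simp add: embed_def)

lemma embed_map_apply:
  assumes "inj_on c (pts X)" and "x \<in> pts X"
  shows "embed_map c d X f (c x) = d (f x)"
  using assms by (simp add: embed_map_def)

lemma finite_gset_embed:
  assumes "finite_gset G X" and c: "inj_on c (pts X)"
  shows "finite_gset G (embed c X)"
proof (rule finite_gsetI)
  note X = finite_gsetD[OF assms(1)]
  show "group G" by (rule X)
  show "finite (pts (embed c X))" using X(2) by simp
  show "act (embed c X) g \<in> extensional (pts (embed c X))" for g by (simp add: embed_def)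
qed (use finite_gsetD[OF assms(1)] in \<open>auto simp: act_embed[OF c]\<close>)

lemma gmap_embed:
  assumes X: "finite_gset G X" and c: "inj_on c (pts X)" and d: "inj_on d (pts Y)"
    and "\<And>x. x \<in> pts X \<Longrightarrow> f x \<in> pts Y"
    and "\<And>g x. \<lbrakk>g \<in> carrier G; x \<in> pts X\<rbrakk> \<Longrightarrow> f (act X g x) = act Y g (f x)"
  shows "gmap G (embed c X) (embed d Y) (embed_map c d X f)"
proof (rule gmapI)
  show "embed_map c d X f \<in> extensional (pts (embed c X))" by (simp add: embed_map_def)
qed (use assms finite_gsetD(4)[OF X] in
  \<open>auto simp: act_embed[OF c] act_embed[OF d] embed_map_apply[OF c]\<close>)

lemma pts_triv [simp]: "pts (triv A) = pts A"
  and act_triv: "act (triv A) g = act A (fst g)"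
  by (simp_all add: triv_def split_beta)

lemma triv_embed: "triv (embed c X) = embed c (triv X)"
  by (simp add: triv_def embed_def fun_eq_iff)

lemma finite_gset_triv:
  assumes "finite_gset G A" and "group S"
  shows "finite_gset (G \<times>\<times> S) (triv A)"
proof (rule finite_gsetI)
  show "group (G \<times>\<times> S)" using assms finite_gsetD(1) by (blast intro: DirProd_group)
qed (use finite_gsetD[OF assms(1)] in \<open>auto simp: act_triv mult_DirProd'\<close>)

section \<open>Coset spaces and their projections to G/L\<close>

context group
begin

lemma pts_homog: "pts (homog G A) = (\<lambda>a. a <# A) ` carrier G"
  by (auto simp: homog_def LCOSETS_def)

lemma act_homog: "C \<in> pts (homog G A) \<Longrightarrow> act (homog G A) g C = g <# C"
  by (simp add: homog_def)

lemma finite_gset_homog: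
  assumes "finite (carrier G)" and "A \<subseteq> carrier G"
  shows "finite_gset G (homog G A)"
proof (rule finite_gsetI)
  have closed: "g <# C \<in> pts (homog G A)" if "g \<in> carrier G" "C \<in> pts (homog G A)" for g C
    using that assms(2) by (auto simp: pts_homog lcos_m_assoc)
  have sub: "C \<subseteq> carrier G" if "C \<in> pts (homog G A)" for C
    using that assms(2) l_coset_subset_G by (auto simp: pts_homog)
  show "group G" by (rule is_group)
  show "finite (pts (homog G A))" using assms(1) by (simp add: pts_homog)
  show "act (homog G A) g \<in> extensional (pts (homog G A))" for g by (simp add: homog_def)
  show "act (homog G A) g C \<in> pts (homog G A)" if "g \<in> carrier G" "C \<in> pts (homog G A)" for g C
    using that closed by (simp add: act_homog)
  show "act (homog G A) \<one> C = C" if "C \<in> pts (homog G A)" for C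
    using that sub by (simp add: act_homog lcos_mult_one)
  show "act (homog G A) (g \<otimes> h) C = act (homog G A) g (act (homog G A) h C)"
    if "g \<in> carrier G" "h \<in> carrier G" "C \<in> pts (homog G A)" for g h C
    using that sub closed by (simp add: act_homog lcos_m_assoc)
qed

text \<open>Evaluates projections to G/L: A is the first projection of \<Lambda> in the case of
  \<open>coset_proj\<close>, and H or a coset inside L in the case of
  \<open>fibre_proj\<close>.\<close>

lemma subset_set_mult_subgroup:
  assumes "subgroup L G" and "A \<subseteq> L" and "A \<noteq> {}"
  shows "A <#> L = L"
proof
  show "A <#> L \<subseteq> L" using assms subgroup.m_closed by (fastforce simp: set_mult_def)
  show "L \<subseteq> A <#> L"
  proof
    fix l assume l: "l \<in> L"
    obtain a where a: "a \<in> A" using assms(3) by blast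
    have "l = a \<otimes> (inv a \<otimes> l)"
      using a l assms(1,2) by (simp flip: m_assoc add: subgroup.mem_carrier subsetD)
    moreover have "inv a \<otimes> l \<in> L"
      using a l assms(1,2) by (auto intro: subgroup.m_closed subgroup.m_inv_closed)
    ultimately show "l \<in> A <#> L" using a by (auto simp: set_mult_def)
  qed
qed

lemma l_coset_set_mult:
  assumes "g \<in> carrier G" and "A \<subseteq> carrier G" and "B \<subseteq> carrier G"
  shows "(g <# A) <#> B = g <# (A <#> B)"
  using assms set_mult_assoc[of "{g}" A B] by (simp add: l_coset_eq_set_mult)

lemma finite_gset_base:
  assumes "finite (carrier G)" and "subgroup L G"
  shows "finite_gset (G \<times>\<times> sym_group m) (triv (base G L))"
  unfolding base_def using assms
  by (intro finite_gset_triv finite_gset_embed finite_gset_homog sym_group_is_group subgroup.subset)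
    (auto simp: inj_on_def)

lemma group_prod: "group (G \<times>\<times> sym_group m)"
  by (intro DirProd_group is_group sym_group_is_group)

lemma finite_carrier_prod:
  "finite (carrier G) \<Longrightarrow> finite (carrier (G \<times>\<times> sym_group m))"
  by (simp add: sym_group_def finite_permutations)

lemma finite_gset_orbit:
  assumes "finite (carrier G)" and "\<Lambda> \<subseteq> carrier (G \<times>\<times> sym_group m)"
  shows "finite_gset (G \<times>\<times> sym_group m) (embed GSCoset (homog (G \<times>\<times> sym_group m) \<Lambda>))"
  by (intro finite_gset_embed group.finite_gset_homog group_prod finite_carrier_prod assms)
    (simp add: inj_on_def)

lemma coset_proj_l_coset:
  assumes \<gamma>: "\<gamma> \<in> carrier (G \<times>\<times> sym_group m)" and \<Lambda>: "\<Lambda> \<subseteq> L \<times> carrier (sym_group m)" "\<Lambda> \<noteq> {}"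
    and L: "subgroup L G"
  shows "coset_proj G L (\<gamma> <#\<^bsub>G \<times>\<times> sym_group m\<^esub> \<Lambda>) = fst \<gamma> <# L"
proof -
  have "fst ` (\<gamma> <#\<^bsub>G \<times>\<times> sym_group m\<^esub> \<Lambda>) = fst \<gamma> <# (fst ` \<Lambda>)"
    by (force simp: l_coset_def mult_DirProd')
  then have "coset_proj G L (\<gamma> <#\<^bsub>G \<times>\<times> sym_group m\<^esub> \<Lambda>) = fst \<gamma> <# (fst ` \<Lambda> <#> L)"
    unfolding coset_proj_def using \<gamma> \<Lambda> subgroup.subset[OF L]
    by (simp, intro l_coset_set_mult) auto
  also have "fst ` \<Lambda> <#> L = L" by (rule subset_set_mult_subgroup[OF L]) (use \<Lambda> in auto)
  finally show ?thesis .
qed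

lemma gmap_coset_proj:
  assumes "finite (carrier G)" and L: "subgroup L G"
    and \<Lambda>: "\<Lambda> \<subseteq> L \<times> carrier (sym_group m)" "\<Lambda> \<noteq> {}"
  shows "gmap (G \<times>\<times> sym_group m) (embed GSCoset (homog (G \<times>\<times> sym_group m) \<Lambda>))
    (triv (base G L)) (embed_map GSCoset GCoset (homog (G \<times>\<times> sym_group m) \<Lambda>) (coset_proj G L))"
  unfolding base_def triv_embed
proof (rule gmap_embed)
  interpret P: group "G \<times>\<times> sym_group m" by (rule group_prod)
  have \<Lambda>c: "\<Lambda> \<subseteq> carrier (G \<times>\<times> sym_group m)" using \<Lambda> subgroup.subset[OF L] by auto
  show "finite_gset (G \<times>\<times> sym_group m) (homog (G \<times>\<times> sym_group m) \<Lambda>)"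
    by (intro P.finite_gset_homog finite_carrier_prod assms(1) \<Lambda>c)
  fix C assume C: "C \<in> pts (homog (G \<times>\<times> sym_group m) \<Lambda>)"
  then obtain \<gamma> where \<gamma>: "\<gamma> \<in> carrier (G \<times>\<times> sym_group m)" "C = \<gamma> <#\<^bsub>G \<times>\<times> sym_group m\<^esub> \<Lambda>"
    by (auto simp: P.pts_homog)
  have eq: "coset_proj G L C = fst \<gamma> <# L"
    unfolding \<gamma>(2) by (rule coset_proj_l_coset[OF \<gamma>(1) \<Lambda> L])
  show m: "coset_proj G L C \<in> pts (triv (homog G L))"
    using \<gamma>(1) unfolding eq by (auto simp: pts_homog)
  fix \<delta> assume \<delta>: "\<delta> \<in> carrier (G \<times>\<times> sym_group m)"
  have "act (homog (G \<times>\<times> sym_group m) \<Lambda>) \<delta> C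
      = (\<delta> \<otimes>\<^bsub>G \<times>\<times> sym_group m\<^esub> \<gamma>) <#\<^bsub>G \<times>\<times> sym_group m\<^esub> \<Lambda>"
    using P.act_homog[OF C] P.lcos_m_assoc[OF \<Lambda>c \<delta> \<gamma>(1)] \<gamma>(2) by simp
  then have "coset_proj G L (act (homog (G \<times>\<times> sym_group m) \<Lambda>) \<delta> C) = (fst \<delta> \<otimes> fst \<gamma>) <# L"
    using coset_proj_l_coset[OF P.m_closed[OF \<delta> \<gamma>(1)] \<Lambda> L] by (simp add: mult_DirProd')
  also have "\<dots> = fst \<delta> <# (fst \<gamma> <# L)"
    using \<delta> \<gamma>(1) subgroup.subset[OF L] by (auto simp: lcos_m_assoc)
  finally show "coset_proj G L (act (homog (G \<times>\<times> sym_group m) \<Lambda>) \<delta> C)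
      = act (triv (homog G L)) \<delta> (coset_proj G L C)"
    using m by (simp add: act_triv act_homog eq)
qed (auto simp: inj_on_def)

section \<open>The action on the complement of the diagonal\<close>

lemma pts_Z_gset: "pts (Z_gset G m L H) = fibre_power G m L H - diagonal G m H"
  by (simp add: Z_gset_def Let_def)

lemma act_Z_gset:
  assumes "x \<in> pts (Z_gset G m L H)" and "\<sigma> permutes {1..m}"
  shows "act (Z_gset G m L H) (g, \<sigma>) x = (\<lambda>i\<in>{1..m}. g <# x (inv' \<sigma> i))"
proof -
  have "inv\<^bsub>sym_group m\<^esub> \<sigma> = inv' \<sigma>" using assms(2) by (simp add: sym_group_carrier)
  then show ?thesis using assms(1) by (simp add: Z_gset_def Let_def)
qed

lemma fibre_powerD:
  assumes "x \<in> fibre_power G m L H"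
  shows "x \<in> extensional {1..m}" and "i \<in> {1..m} \<Longrightarrow> x i \<in> lcosets H"
    and "\<lbrakk>i \<in> {1..m}; j \<in> {1..m}\<rbrakk> \<Longrightarrow> x i <#> L = x j <#> L"
proof -
  have x: "x \<in> {1..m} \<rightarrow>\<^sub>E lcosets H" and L: "\<forall>i\<in>{1..m}. \<forall>j\<in>{1..m}. x i <#> L = x j <#> L"
    using assms unfolding fibre_power_def by blast+
  show "x \<in> extensional {1..m}" "i \<in> {1..m} \<Longrightarrow> x i \<in> lcosets H"
    using x by (auto simp: PiE_iff)
  show "\<lbrakk>i \<in> {1..m}; j \<in> {1..m}\<rbrakk> \<Longrightarrow> x i <#> L = x j <#> L" using L by blast
qed

lemma l_coset_lcosets:
  assumes "subgroup H G" "g \<in> carrier G" "C \<in> lcosets H"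
  shows "g <# C \<in> lcosets H"
  using assms subgroup.subset[OF assms(1)] by (auto simp: LCOSETS_def lcos_m_assoc)

text \<open>If the translated tuple were constant with value C, the original one would be constant
  with value g^-1 C. The tuple is written out instead of \<open>act\<close>, so that the action
  formula can be applied to it a second time when the action law is proved.\<close>

lemma act_Z_gset_closed:
  assumes H: "subgroup H G" and L: "subgroup L G" and x: "x \<in> pts (Z_gset G m L H)"
    and g: "g \<in> carrier G" and \<sigma>: "\<sigma> permutes {1..m}"
  shows "(\<lambda>i\<in>{1..m}. g <# x (inv' \<sigma> i)) \<in> pts (Z_gset G m L H)" (is "?y \<in> _")
proof -
  have xf: "x \<in> fibre_power G m L H" and nd: "x \<notin> diagonal G m H" using x by (auto simp: pts_Z_gset)
  note X = fibre_powerD[OF xf]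
  have inv: "inv' \<sigma> i \<in> {1..m}" if "i \<in> {1..m}" for i
    using that permutes_in_image[OF permutes_inv[OF \<sigma>]] by blast
  have sub: "x i \<subseteq> carrier G" if "i \<in> {1..m}" for i
    using X(2)[OF that] H by (auto dest: lcosets_subset_PowG)
  have eq: "(g <# x i) <#> L = (g <# x j) <#> L" if "i \<in> {1..m}" "j \<in> {1..m}" for i j
    using X(3)[OF that] sub that g subgroup.subset[OF L] by (simp add: l_coset_set_mult)
  have "\<forall>i\<in>{1..m}. \<forall>j\<in>{1..m}. ?y i <#> L = ?y j <#> L"
  proof (intro ballI)
    fix i j assume ij: "i \<in> {1..m}" "j \<in> {1..m}"
    show "?y i <#> L = ?y j <#> L" using eq[OF inv[OF ij(1)] inv[OF ij(2)]] ij by simp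
  qed
  moreover have "?y \<in> {1..m} \<rightarrow>\<^sub>E lcosets H"
    using inv X(2) l_coset_lcosets[OF H g] by (intro restrict_PiE_iff[THEN iffD2]) blast
  ultimately have "?y \<in> fibre_power G m L H" unfolding fibre_power_def by blast
  moreover have "?y \<notin> diagonal G m H"
  proof
    assume "?y \<in> diagonal G m H"
    then obtain C where C: "C \<in> lcosets H" "?y = (\<lambda>i\<in>{1..m}. C)" by (auto simp: diagonal_def)
    have "x i = inv g <# C" if i: "i \<in> {1..m}" for i
    proof -
      have "\<sigma> i \<in> {1..m}" using i permutes_in_image[OF \<sigma>] by blast
      then have "g <# x i = C" using fun_cong[OF C(2), of "\<sigma> i"] permutes_inverses(2)[OF \<sigma>] by simp
      then have "inv g <# C = (inv g \<otimes> g) <# x i" using g sub[OF i] by (auto simp: lcos_m_assoc)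
      then show ?thesis using g sub[OF i] by (simp add: lcos_mult_one)
    qed
    then have "x = (\<lambda>i\<in>{1..m}. inv g <# C)" using X(1) by (auto intro: extensionalityI)
    then show False using nd l_coset_lcosets[OF H _ C(1)] g by (auto simp: diagonal_def)
  qed
  ultimately show ?thesis by (simp add: pts_Z_gset)
qed

lemma finite_gset_Z_gset:
  assumes fin: "finite (carrier G)" and H: "subgroup H G" and L: "subgroup L G"
  shows "finite_gset (G \<times>\<times> sym_group m) (Z_gset G m L H)" (is "finite_gset ?P ?Z")
proof (rule finite_gsetI)
  show "group ?P" by (rule group_prod)
  have "finite (lcosets H)" using fin by (simp add: LCOSETS_def)
  then have "finite ({1..m} \<rightarrow>\<^sub>E lcosets H)" by (intro finite_PiE) auto
  then show "finite (pts ?Z)" unfolding pts_Z_gset fibre_power_def by (auto intro: finite_subset)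
  show "act ?Z \<gamma> \<in> extensional (pts ?Z)" for \<gamma>
    by (simp add: Z_gset_def Let_def split_beta)
  show "act ?Z \<gamma> x \<in> pts ?Z" if "\<gamma> \<in> carrier ?P" "x \<in> pts ?Z" for \<gamma> x
    using that act_Z_gset_closed[OF H L] by (auto simp: act_Z_gset sym_group_carrier)
  have sub: "x i \<subseteq> carrier G" if "x \<in> pts ?Z" "i \<in> {1..m}" for x i
    using that H by (auto simp: pts_Z_gset dest!: fibre_powerD(2) lcosets_subset_PowG)
  show "act ?Z \<one>\<^bsub>?P\<^esub> x = x" if x: "x \<in> pts ?Z" for x
  proof -
    have "x \<in> extensional {1..m}" using x by (auto simp: pts_Z_gset dest: fibre_powerD)
    then have "(\<lambda>i\<in>{1..m}. \<one> <# x i) = x"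
      using sub[OF x] by (intro extensionalityI[of _ "{1..m}"]) (auto simp: lcos_mult_one)
    then show ?thesis using x by (simp add: act_Z_gset sym_group_one permutes_id)
  qed
  show "act ?Z (\<gamma> \<otimes>\<^bsub>?P\<^esub> \<delta>) x = act ?Z \<gamma> (act ?Z \<delta> x)"
    if \<gamma>: "\<gamma> \<in> carrier ?P" and \<delta>: "\<delta> \<in> carrier ?P" and x: "x \<in> pts ?Z" for \<gamma> \<delta> x
  proof -
    obtain g \<sigma> h \<tau> where gh: "\<gamma> = (g, \<sigma>)" "\<delta> = (h, \<tau>)" by (cases \<gamma>, cases \<delta>)
    then have g: "g \<in> carrier G" and h: "h \<in> carrier G"
      and \<sigma>: "\<sigma> permutes {1..m}" and \<tau>: "\<tau> permutes {1..m}"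
      using \<gamma> \<delta> by (auto simp: sym_group_carrier)
    have inv: "inv' p i \<in> {1..m}" if "i \<in> {1..m}" "p permutes {1..m}" for i p
      using that(1) permutes_in_image[OF permutes_inv[OF that(2)]] by blast
    have "(g \<otimes> h) <# x (inv' (\<sigma> \<circ> \<tau>) i) = g <# (h <# x (inv' \<tau> (inv' \<sigma> i)))"
      if i: "i \<in> {1..m}" for i
    proof -
      \<comment> \<open>Inversion reverses composition, which is why precomposing with the inverse
        gives a left action.\<close>
      have "inv' (\<sigma> \<circ> \<tau>) = inv' \<tau> \<circ> inv' \<sigma>"
        using \<sigma> \<tau> by (simp add: o_inv_distrib permutes_bij)
      then show ?thesis
        using lcos_m_assoc[OF sub[OF x inv[OF inv[OF i \<sigma>] \<tau>]] g h] by simp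
    qed
    then show ?thesis
      using \<sigma> \<tau> x inv act_Z_gset_closed[OF H L x h \<tau>]
      by (auto simp: gh sym_group_mult act_Z_gset permutes_compose intro!: restrict_ext)
  qed
qed

lemma gmap_fibre_proj:
  assumes fin: "finite (carrier G)" and H: "subgroup H G" and L: "subgroup L G"
    and HL: "H \<subseteq> L" and m: "m \<ge> 1"
  shows "gmap (G \<times>\<times> sym_group m) (embed Tuple (Z_gset G m L H)) (triv (base G L))
    (embed_map Tuple GCoset (Z_gset G m L H) (fibre_proj G L))"
  unfolding base_def triv_embed
proof (rule gmap_embed)
  let ?P = "G \<times>\<times> sym_group m" and ?Z = "Z_gset G m L H"
  show "finite_gset ?P ?Z" by (rule finite_gset_Z_gset) fact+
  fix x assume x: "x \<in> pts ?Z"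
  then have xf: "x \<in> fibre_power G m L H" by (simp add: pts_Z_gset)
  note X = fibre_powerD[OF xf]
  have m1: "1 \<in> {1..m}" using m by simp
  have "H <#> L = L" by (rule subset_set_mult_subgroup[OF L HL]) (use H subgroup.one_closed in blast)
  moreover obtain a where a: "a \<in> carrier G" "x 1 = a <# H"
    using X(2)[OF m1] by (auto simp: LCOSETS_def)
  ultimately have "x 1 <#> L = a <# L"
    using l_coset_set_mult[of a H L] subgroup.subset[OF L] subgroup.subset[OF H] by simp
  then show p: "fibre_proj G L x \<in> pts (triv (homog G L))"
    using a by (auto simp: fibre_proj_def pts_homog)
  fix \<gamma> assume "\<gamma> \<in> carrier ?P"
  then obtain g \<sigma> where \<gamma>: "\<gamma> = (g, \<sigma>)" and g: "g \<in> carrier G" and \<sigma>: "\<sigma> permutes {1..m}"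
    by (auto simp: sym_group_carrier)
  have i: "inv' \<sigma> 1 \<in> {1..m}" using m1 permutes_in_image[OF permutes_inv[OF \<sigma>]] by blast
  have "x (inv' \<sigma> 1) \<subseteq> carrier G" using X(2)[OF i] H by (auto dest: lcosets_subset_PowG)
  \<comment> \<open>The first entry of the translated tuple is g times the entry at \<sigma>^-1 1;
    modulo L the fibre condition replaces that entry by the one at 1.\<close>
  then have "fibre_proj G L (act ?Z \<gamma> x) = g <# (x (inv' \<sigma> 1) <#> L)"
    using act_Z_gset[OF x \<sigma>] m1 g subgroup.subset[OF L] by (simp add: fibre_proj_def \<gamma> l_coset_set_mult)
  also have "x (inv' \<sigma> 1) <#> L = x 1 <#> L" by (rule X(3)[OF i m1])
  finally show "fibre_proj G L (act ?Z \<gamma> x) = act (triv (homog G L)) \<gamma> (fibre_proj G L x)"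
    using p by (simp add: act_triv act_homog \<gamma> fibre_proj_def)
qed (auto simp: inj_on_def)

end

section \<open>Young subgroups and wreath products\<close>

lemma permutes_if_inj_on:
  assumes "finite A" and "inj_on f A" and "\<And>x. x \<in> A \<Longrightarrow> f x \<in> A" and "\<And>x. x \<notin> A \<Longrightarrow> f x = x"
  shows "f permutes A"
proof (rule bij_imp_permutes[OF _ assms(4)])
  have "f ` A \<subseteq> A" using assms(3) by blast
  then show "bij_betw f A A" using assms(1,2) by (simp add: bij_betw_def endo_inj_surj)
qed

text \<open>Equal fibre sizes say that both functions have the same multiset of values over D, and
  such functions differ by a permutation of D. The permutations \<sigma>0 of both cases come from
  here.\<close>

lemma exists_permutation_matching_fibres:
  assumes "finite D" and "\<And>c. card {k \<in> D. a k = c} = card {k \<in> D. b k = c}"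
  obtains \<sigma> where "\<sigma> permutes D" and "\<And>k. k \<in> D \<Longrightarrow> a (\<sigma> k) = b k"
proof -
  have "image_mset b (mset_set D) = image_mset a (mset_set D)"
    by (rule multiset_eqI) (simp add: count_image_mset_eq_card_vimage assms)
  from image_mset_eq_implies_permutes[OF assms(1) this] that show ?thesis by metis
qed

text \<open>This form exhibits the Young subgroup as the stabilizer of the colouring
  \<open>k \<le> i\<close>. For the converse, \<alpha> and \<beta> are the restrictions of \<sigma>
  to the two intervals, extended by the identity.\<close>

lemma young_iff:
  "\<sigma> \<in> young i j \<longleftrightarrow> \<sigma> permutes {1..i + j} \<and> (\<forall>k\<in>{1..i + j}. \<sigma> k \<le> i \<longleftrightarrow> k \<le> i)"
    (is "_ \<longleftrightarrow> ?P \<and> ?Q")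
proof
  assume "\<sigma> \<in> young i j"
  then obtain \<alpha> \<beta> where \<alpha>: "\<alpha> permutes {1..i}" and \<beta>: "\<beta> permutes {i + 1..i + j}" and \<sigma>: "\<sigma> = \<alpha> \<circ> \<beta>"
    by (auto simp: young_def)
  have "?P"
    unfolding \<sigma> by (rule permutes_compose; rule permutes_subset) (use \<alpha> \<beta> in auto)
  moreover have "\<sigma> k \<le> i \<longleftrightarrow> k \<le> i" if k: "k \<in> {1..i + j}" for k
  proof (cases "k \<le> i")
    case True
    then have "\<sigma> k = \<alpha> k" using permutes_not_in[OF \<beta>, of k] by (simp add: \<sigma>)
    then show ?thesis using permutes_in_image[OF \<alpha>, of k] k True by auto
  next
    case False
    then have "\<beta> k \<in> {i + 1..i + j}" using permutes_in_image[OF \<beta>, of k] k by auto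
    then show ?thesis using permutes_not_in[OF \<alpha>, of "\<beta> k"] False by (simp add: \<sigma>)
  qed
  ultimately show "?P \<and> ?Q" by blast
next
  assume "?P \<and> ?Q"
  then have P: ?P and Q: "\<And>k. k \<in> {1..i + j} \<Longrightarrow> \<sigma> k \<le> i \<longleftrightarrow> k \<le> i" by auto
  have inj: "\<sigma> x = \<sigma> y \<longleftrightarrow> x = y" for x y using permutes_inj[OF P] by (auto dest: injD)
  have im: "\<sigma> k \<in> {1..i + j} \<longleftrightarrow> k \<in> {1..i + j}" for k by (rule permutes_in_image[OF P])
  define \<alpha> \<beta> where "\<alpha> = (\<lambda>k. if k \<in> {1..i} then \<sigma> k else k)"
    and "\<beta> = (\<lambda>k. if k \<in> {i + 1..i + j} then \<sigma> k else k)"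
  have "\<alpha> permutes {1..i}"
  proof (rule permutes_if_inj_on)
    show "\<alpha> k \<in> {1..i}" if "k \<in> {1..i}" for k
      using that Q[of k] im[of k] by (auto simp: \<alpha>_def)
  qed (auto simp: \<alpha>_def inj inj_on_def)
  moreover have \<beta>: "\<beta> k \<in> {i + 1..i + j}" if "k \<in> {i + 1..i + j}" for k
    using that Q[of k] im[of k] by (auto simp: \<beta>_def)
  then have "\<beta> permutes {i + 1..i + j}"
    by (rule permutes_if_inj_on[rotated 2]) (auto simp: \<beta>_def inj inj_on_def)
  moreover have "\<sigma> = \<alpha> \<circ> \<beta>"
  proof
    fix k
    consider "k \<in> {1..i}" | "k \<in> {i + 1..i + j}" | "k \<notin> {1..i + j}" by force
    then show "\<sigma> k = (\<alpha> \<circ> \<beta>) k"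
    proof cases
      case 2
      then show ?thesis using \<beta>[of k] by (simp add: \<alpha>_def \<beta>_def)
    next
      case 3
      then have "\<sigma> k = k" by (rule permutes_not_in[OF P])
      then show ?thesis using 3 by (simp add: \<alpha>_def \<beta>_def)
    qed (simp add: \<alpha>_def \<beta>_def)
  qed
  ultimately show "\<sigma> \<in> young i j" by (auto simp: young_def)
qed

section \<open>Block and offset coordinates, and wreath products\<close>

definition block :: "nat \<Rightarrow> nat \<Rightarrow> nat" where
  "block q k = (k - 1) div q + 1"

text \<open>\<open>block\<close> and \<open>offset\<close> invert the numbering (b - 1) * q + r of
  \<open>wreath_perm\<close>; the shifts occur because positions, blocks and offsets all start at
  1.\<close>

definition offset :: "nat \<Rightarrow> nat \<Rightarrow> nat" where
  "offset q k = (k - 1) mod q + 1"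

lemma block_offset_bounds:
  assumes "k \<in> {1..q * n}"
  shows "block q k \<in> {1..n}" and "offset q k \<in> {1..q}"
proof -
  have "q > 0" and "k - 1 < n * q" using assms by (cases q; auto simp: mult.commute)+
  then show "block q k \<in> {1..n}" "offset q k \<in> {1..q}"
    by (auto simp: block_def offset_def less_mult_imp_div_less Suc_le_eq)
qed

lemma block_offset_eq:
  assumes "k \<ge> 1"
  shows "(block q k - 1) * q + offset q k = k"
  using assms by (simp add: block_def offset_def)

lemma block_offset_inject:
  assumes "k \<ge> 1" and "l \<ge> 1" and "block q k = block q l" and "offset q k = offset q l"
  shows "k = l"
  using block_offset_eq[OF assms(1)] block_offset_eq[OF assms(2)] assms(3,4) by metis

lemma block_offset_of:
  assumes "b \<in> {1..n}" and "r \<in> {1..q}"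
  shows "(b - 1) * q + r \<in> {1..q * n}"
    and "block q ((b - 1) * q + r) = b" and "offset q ((b - 1) * q + r) = r"
proof -
  obtain c s where c: "b = Suc c" "r = Suc s" using assms by (cases b; cases r; auto)
  have "c * q + s < Suc c * q" using assms c by simp
  also have "\<dots> \<le> n * q" using assms c by (intro mult_right_mono) auto
  finally show "(b - 1) * q + r \<in> {1..q * n}" using c by (simp add: mult.commute)
  show "block q ((b - 1) * q + r) = b" "offset q ((b - 1) * q + r) = r"
    using assms c by (auto simp: block_def offset_def)
qed

text \<open>This is the number of times that the model tuple
  \<open>\<lambda>k. e (block q k)\<close> repeats each coset, to be matched with the fibres of a
  given tuple.\<close>

lemma card_block:
  assumes "b \<in> {1..n}"
  shows "card {k \<in> {1..q * n}. block q k = b} = q"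
proof -
  have "bij_betw (\<lambda>r. (b - 1) * q + r) {1..q} {k \<in> {1..q * n}. block q k = b}"
  proof (rule bij_betw_byWitness[where f' = "offset q"])
    show "\<forall>k\<in>{k \<in> {1..q * n}. block q k = b}. (b - 1) * q + offset q k = k"
      using block_offset_eq by auto
    show "offset q ` {k \<in> {1..q * n}. block q k = b} \<subseteq> {1..q}"
      using block_offset_bounds(2) by blast
    show "(\<lambda>r. (b - 1) * q + r) ` {1..q} \<subseteq> {k \<in> {1..q * n}. block q k = b}"
      using block_offset_of[OF assms] by blast
    show "\<forall>r\<in>{1..q}. offset q ((b - 1) * q + r) = r" using block_offset_of[OF assms] by blast
  qed
  from bij_betw_same_card[OF this] show ?thesis by simp
qed

lemma wreath_perm_eq:
  "k \<in> {1..q * n} \<Longrightarrow>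
    wreath_perm q n f \<tau> k = (\<tau> (block q k) - 1) * q + f (block q k) (offset q k)"
  by (simp add: wreath_perm_def block_def offset_def Let_def)

text \<open>In coordinates the map is (b, r) \<mapsto> (\<tau> b, f_b r): equal images force equal
  blocks by injectivity of \<tau>, then equal offsets by injectivity of f_b.\<close>

lemma wreath_perm_permutes:
  assumes \<tau>: "\<tau> permutes {1..n}" and f: "\<And>b. b \<in> {1..n} \<Longrightarrow> f b permutes {1..q}"
  shows "wreath_perm q n f \<tau> permutes {1..q * n}"
    and "k \<in> {1..q * n} \<Longrightarrow> block q (wreath_perm q n f \<tau> k) = \<tau> (block q k)"
proof -
  have *: "wreath_perm q n f \<tau> k \<in> {1..q * n}"
      "block q (wreath_perm q n f \<tau> k) = \<tau> (block q k)"
      "offset q (wreath_perm q n f \<tau> k) = f (block q k) (offset q k)" if k: "k \<in> {1..q * n}" for k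
  proof -
    have "\<tau> (block q k) \<in> {1..n}" "f (block q k) (offset q k) \<in> {1..q}"
      using block_offset_bounds[OF k] permutes_in_image[OF \<tau>] permutes_in_image[OF f] by blast+
    from block_offset_of[OF this] show "wreath_perm q n f \<tau> k \<in> {1..q * n}"
      "block q (wreath_perm q n f \<tau> k) = \<tau> (block q k)"
      "offset q (wreath_perm q n f \<tau> k) = f (block q k) (offset q k)"
      by (simp_all only: wreath_perm_eq[OF k])
  qed
  show "k \<in> {1..q * n} \<Longrightarrow> block q (wreath_perm q n f \<tau> k) = \<tau> (block q k)" by (rule *)
  show "wreath_perm q n f \<tau> permutes {1..q * n}"
  proof (rule permutes_if_inj_on)
    show "inj_on (wreath_perm q n f \<tau>) {1..q * n}"
    proof (rule inj_onI)
      fix k l assume k: "k \<in> {1..q * n}" and l: "l \<in> {1..q * n}"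
        and eq: "wreath_perm q n f \<tau> k = wreath_perm q n f \<tau> l"
      have b: "block q k = block q l"
        by (rule injD[OF permutes_inj[OF \<tau>]]) (metis *(2)[OF k] *(2)[OF l] eq)
      have "offset q k = offset q l"
        by (rule injD[OF permutes_inj[OF f[OF block_offset_bounds(1)[OF k]]]])
          (metis *(3)[OF k] *(3)[OF l] eq b)
      with b show "k = l" using k l block_offset_inject[of k l q] by simp
    qed
  qed (use *(1) in \<open>auto simp: wreath_perm_def\<close>)
qed

text \<open>f_b is read off as the offset of the image. It is injective because the images of one
  block lie in a single block, where the offset determines the position.\<close>

lemma permutes_blocks_imp_wreath_perm:
  assumes \<sigma>: "\<sigma> permutes {1..q * n}"
    and \<tau>: "\<And>k. k \<in> {1..q * n} \<Longrightarrow> block q (\<sigma> k) = \<tau> (block q k)"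
  obtains f where "\<And>b. b \<in> {1..n} \<Longrightarrow> f b permutes {1..q}" and "\<sigma> = wreath_perm q n f \<tau>"
proof -
  define f where "f = (\<lambda>b r. if r \<in> {1..q} then offset q (\<sigma> ((b - 1) * q + r)) else r)"
  have im: "\<sigma> k \<in> {1..q * n}" if "k \<in> {1..q * n}" for k using that permutes_in_image[OF \<sigma>] by blast
  have "f b permutes {1..q}" if b: "b \<in> {1..n}" for b
  proof (rule permutes_if_inj_on)
    note of = block_offset_of[OF b]
    show "f b r \<in> {1..q}" if "r \<in> {1..q}" for r
      using block_offset_bounds(2)[OF im[OF of(1)[OF that]]] that by (simp add: f_def)
    show "inj_on (f b) {1..q}"
    proof (rule inj_onI)
      fix r s assume r: "r \<in> {1..q}" and s: "s \<in> {1..q}" and eq: "f b r = f b s"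
      have "\<sigma> ((b - 1) * q + r) = \<sigma> ((b - 1) * q + s)"
      proof (rule block_offset_inject)
        show "\<sigma> ((b - 1) * q + r) \<ge> 1" "\<sigma> ((b - 1) * q + s) \<ge> 1"
          using im[OF of(1)[OF r]] im[OF of(1)[OF s]] by simp_all
        show "block q (\<sigma> ((b - 1) * q + r)) = block q (\<sigma> ((b - 1) * q + s))"
          using \<tau>[OF of(1)[OF r]] \<tau>[OF of(1)[OF s]] of(2)[OF r] of(2)[OF s] by simp
        show "offset q (\<sigma> ((b - 1) * q + r)) = offset q (\<sigma> ((b - 1) * q + s))"
          using eq r s by (simp add: f_def)
      qed
      then have "(b - 1) * q + r = (b - 1) * q + s" by (rule injD[OF permutes_inj[OF \<sigma>]])
      then show "r = s" by simp
    qed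
  qed (auto simp: f_def)
  moreover have "\<sigma> k = wreath_perm q n f \<tau> k" for k
  proof (cases "k \<in> {1..q * n}")
    case True
    have "wreath_perm q n f \<tau> k = (block q (\<sigma> k) - 1) * q + offset q (\<sigma> k)"
      using block_offset_bounds(2)[OF True] block_offset_eq[of k q] True
      by (simp only: wreath_perm_eq[OF True] \<tau>[OF True] f_def) simp
    also have "\<dots> = \<sigma> k" using im[OF True] by (intro block_offset_eq) simp
    finally show ?thesis by simp
  next
    case False
    then have "wreath_perm q n f \<tau> k = k" by (auto simp: wreath_perm_def)
    then show ?thesis using permutes_not_in[OF \<sigma> False] by simp
  qed
  ultimately show ?thesis using that by blast
qed

text \<open>\<open>action_perm\<close> is built with an inverse of e; the equivariance of e is the
  form in which it is used later. Injectivity of e turns cancellation in A into injectivity on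
  indices.\<close>

lemma action_perm_permutes:
  assumes e: "bij_betw e {1..n} A"
    and closed: "\<And>C. C \<in> A \<Longrightarrow> s <#\<^bsub>G\<^esub> C \<in> A" and inj: "inj_on (\<lambda>C. s <#\<^bsub>G\<^esub> C) A"
  shows "action_perm G n e s permutes {1..n}"
    and "b \<in> {1..n} \<Longrightarrow> e (action_perm G n e s b) = s <#\<^bsub>G\<^esub> e b"
proof -
  have eA: "e b \<in> A" if "b \<in> {1..n}" for b using that e by (auto simp: bij_betw_def)
  show eq: "e (action_perm G n e s b) = s <#\<^bsub>G\<^esub> e b" if "b \<in> {1..n}" for b
    using that closed[OF eA[OF that]] bij_betw_inv_into_right[OF e] by (simp add: action_perm_def)
  show "action_perm G n e s permutes {1..n}"
  proof (rule permutes_if_inj_on)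
    show "action_perm G n e s b \<in> {1..n}" if "b \<in> {1..n}" for b
      using that closed[OF eA[OF that]] e
      by (auto simp: action_perm_def bij_betw_def simp del: atLeastAtMost_iff intro: inv_into_into)
    show "inj_on (action_perm G n e s) {1..n}"
    proof (rule inj_onI)
      fix b c assume b: "b \<in> {1..n}" and c: "c \<in> {1..n}"
        and "action_perm G n e s b = action_perm G n e s c"
      then have "s <#\<^bsub>G\<^esub> e b = s <#\<^bsub>G\<^esub> e c" using eq[OF b] eq[OF c] by simp
      then have "e b = e c" using inj eA[OF b] eA[OF c] by (auto dest: inj_onD)
      then show "b = c" using e b c by (auto simp: bij_betw_def dest: inj_onD)
    qed
  qed (auto simp: action_perm_def)
qed

text \<open>The group \<open>\<Sigma>\<^sub>q \<wr> \<Gamma>(a\<^bsub>S/K\<^esub>)\<close> is the stabilizer of the tuple that repeats every coset in \<open>S/K\<close>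
  \<open>q\<close> times.\<close>

lemma mem_wreath_preimage_graph_subgroup:
  assumes e: "bij_betw e {1..n} A"
    and closed: "\<And>s C. \<lbrakk>s \<in> S; C \<in> A\<rbrakk> \<Longrightarrow> s <#\<^bsub>G\<^esub> C \<in> A"
    and inj: "\<And>s. s \<in> S \<Longrightarrow> inj_on (\<lambda>C. s <#\<^bsub>G\<^esub> C) A"
  shows "(s, \<sigma>) \<in> wreath_preimage q n (graph_subgroup G n e S) \<longleftrightarrow>
    s \<in> S \<and> \<sigma> permutes {1..q * n} \<and>
    (\<forall>k\<in>{1..q * n}. e (block q (\<sigma> k)) = s <#\<^bsub>G\<^esub> e (block q k))"
proof
  assume "(s, \<sigma>) \<in> wreath_preimage q n (graph_subgroup G n e S)"
  then obtain f where s: "s \<in> S" and f: "\<And>b. b \<in> {1..n} \<Longrightarrow> f b permutes {1..q}"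
    and \<sigma>: "\<sigma> = wreath_perm q n f (action_perm G n e s)"
    unfolding wreath_preimage_def graph_subgroup_def by blast
  note ap = action_perm_permutes[OF e closed[OF s] inj[OF s]]
  have \<tau>: "action_perm G n e s permutes {1..n}" using ap(1) by blast
  note wp = wreath_perm_permutes[where f = f, OF \<tau> f]
  show "s \<in> S \<and> \<sigma> permutes {1..q * n} \<and>
      (\<forall>k\<in>{1..q * n}. e (block q (\<sigma> k)) = s <#\<^bsub>G\<^esub> e (block q k))"
  proof (intro conjI ballI)
    fix k assume k: "k \<in> {1..q * n}"
    show "e (block q (\<sigma> k)) = s <#\<^bsub>G\<^esub> e (block q k)"
      using wp(2)[OF _ k] ap(2)[OF _ block_offset_bounds(1)[OF k]] by (simp add: \<sigma>)
  qed (use s \<sigma> wp(1) in auto)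
next
  assume "s \<in> S \<and> \<sigma> permutes {1..q * n} \<and>
    (\<forall>k\<in>{1..q * n}. e (block q (\<sigma> k)) = s <#\<^bsub>G\<^esub> e (block q k))"
  then have s: "s \<in> S" and \<sigma>: "\<sigma> permutes {1..q * n}"
    and eq: "\<And>k. k \<in> {1..q * n} \<Longrightarrow> e (block q (\<sigma> k)) = s <#\<^bsub>G\<^esub> e (block q k)" by blast+
  note ap = action_perm_permutes[OF e closed[OF s] inj[OF s]]
  \<comment> \<open>The hypothesis speaks of cosets; injectivity of e turns it into a condition on
    blocks, which exhibits \<sigma> as a wreath element over \<open>action_perm\<close>.\<close>
  have "block q (\<sigma> k) = action_perm G n e s (block q k)" if k: "k \<in> {1..q * n}" for k
  proof -
    have b: "block q k \<in> {1..n}" by (rule block_offset_bounds[OF k])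
    have "\<sigma> k \<in> {1..q * n}" using k permutes_in_image[OF \<sigma>] by blast
    then have "block q (\<sigma> k) \<in> {1..n}" by (rule block_offset_bounds)
    moreover have "action_perm G n e s (block q k) \<in> {1..n}" using b permutes_in_image[OF ap(1)] by blast
    moreover have "e (block q (\<sigma> k)) = e (action_perm G n e s (block q k))"
      using eq[OF k] ap(2)[OF _ b] by simp
    ultimately show ?thesis using e by (auto simp: bij_betw_def dest: inj_onD)
  qed
  then obtain f where "\<And>b. b \<in> {1..n} \<Longrightarrow> f b permutes {1..q}"
    "\<sigma> = wreath_perm q n f (action_perm G n e s)"
    using permutes_blocks_imp_wreath_perm[OF \<sigma>] by blast
  then show "(s, \<sigma>) \<in> wreath_preimage q n (graph_subgroup G n e S)"
    using s unfolding wreath_preimage_def graph_subgroup_def by blast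
qed

section \<open>Stabilizers of tuples\<close>

text \<open>The equation is the fixed point condition t = \<alpha> g \<circ> t \<circ> \<sigma>^-1,
  evaluated at \<sigma> k so that no inverse remains. The type of entries stays open so that cosets
  and Booleans are both covered.\<close>

definition tuple_stabilizer ::
  "'g set \<Rightarrow> nat \<Rightarrow> ('g \<Rightarrow> 'x \<Rightarrow> 'x) \<Rightarrow> (nat \<Rightarrow> 'x) \<Rightarrow> ('g \<times> (nat \<Rightarrow> nat)) set" where
  "tuple_stabilizer A m \<alpha> t =
     {(g, \<sigma>). g \<in> A \<and> \<sigma> permutes {1..m} \<and> (\<forall>k\<in>{1..m}. t (\<sigma> k) = \<alpha> g (t k))}"

lemma mem_tuple_stabilizer:
  "(g, \<sigma>) \<in> tuple_stabilizer A m \<alpha> t \<longleftrightarrow>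
    g \<in> A \<and> \<sigma> permutes {1..m} \<and> (\<forall>k\<in>{1..m}. t (\<sigma> k) = \<alpha> g (t k))"
  by (simp add: tuple_stabilizer_def)

text \<open>F \<circ> y \<circ> \<sigma>0 agrees with t, and F commutes with g on the entries of y.
  A permutation that realizes g on y therefore realizes g on t after conjugation by
  \<sigma>0.\<close>

lemma conjugate_tuple_stabilizer:
  assumes \<sigma>0: "\<sigma>0 permutes {1..m}" and t: "\<And>k. k \<in> {1..m} \<Longrightarrow> F (y (\<sigma>0 k)) = t k"
    and g\<sigma>: "(g, \<sigma>) \<in> tuple_stabilizer A m \<alpha> y" and "g \<in> A'"
    and F: "\<And>k. k \<in> {1..m} \<Longrightarrow> F (\<alpha> g (y k)) = \<beta> g (F (y k))"
  shows "(g, inv' \<sigma>0 \<circ> \<sigma> \<circ> \<sigma>0) \<in> tuple_stabilizer A' m \<beta> t"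
proof -
  have \<sigma>: "\<sigma> permutes {1..m}" and y: "\<And>k. k \<in> {1..m} \<Longrightarrow> y (\<sigma> k) = \<alpha> g (y k)"
    using g\<sigma> by (auto simp: mem_tuple_stabilizer)
  let ?\<sigma>' = "inv' \<sigma>0 \<circ> \<sigma> \<circ> \<sigma>0"
  have perm: "?\<sigma>' permutes {1..m}" using \<sigma>0 \<sigma> by (intro permutes_compose permutes_inv)
  have "t (?\<sigma>' k) = \<beta> g (t k)" if k: "k \<in> {1..m}" for k
  proof -
    have k': "\<sigma>0 k \<in> {1..m}" "?\<sigma>' k \<in> {1..m}"
      using k permutes_in_image[OF \<sigma>0] permutes_in_image[OF perm] by blast+
    have "t (?\<sigma>' k) = F (y (\<sigma> (\<sigma>0 k)))"
      using t[OF k'(2)] permutes_inverses(1)[OF \<sigma>0] by simp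
    also have "\<dots> = \<beta> g (F (y (\<sigma>0 k)))" by (simp only: y[OF k'(1)] F[OF k'(1)])
    finally show ?thesis by (simp only: t[OF k])
  qed
  with perm \<open>g \<in> A'\<close> show ?thesis by (simp add: mem_tuple_stabilizer)
qed

lemma young_eq_tuple_stabilizer:
  "A \<times> young i j = tuple_stabilizer A (i + j) (\<lambda>_ b. b) (\<lambda>k. k \<le> i)"
  by (auto simp: tuple_stabilizer_def young_iff)

context group
begin

text \<open>The action laws are asked for at the values of t, because for left multiplication they
  are available on subsets of the carrier.\<close>

lemma subgroup_tuple_stabilizer:
  assumes A: "subgroup A G"
    and one: "\<And>k. k \<in> {1..m} \<Longrightarrow> \<alpha> \<one> (t k) = t k"
    and mult: "\<And>g h k. \<lbrakk>g \<in> A; h \<in> A; k \<in> {1..m}\<rbrakk> \<Longrightarrow> \<alpha> (g \<otimes> h) (t k) = \<alpha> g (\<alpha> h (t k))"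
  shows "subgroup (tuple_stabilizer A m \<alpha> t) (G \<times>\<times> sym_group m)" (is "subgroup ?T ?P")
proof -
  interpret P: group ?P by (rule group_prod)
  interpret A: subgroup A G by (rule A)
  show ?thesis
  proof (rule P.subgroupI)
    show "?T \<subseteq> carrier ?P"
      using A.subset by (auto simp: tuple_stabilizer_def sym_group_carrier)
    have "(\<one>, id) \<in> ?T" using one by (simp add: mem_tuple_stabilizer permutes_id)
    then show "?T \<noteq> {}" by blast
    fix \<gamma> assume \<gamma>: "\<gamma> \<in> ?T"
    obtain g \<sigma> where \<gamma>_eq: "\<gamma> = (g, \<sigma>)" by (cases \<gamma>)
    have g: "g \<in> A" and \<sigma>: "\<sigma> permutes {1..m}" and t: "\<And>k. k \<in> {1..m} \<Longrightarrow> t (\<sigma> k) = \<alpha> g (t k)"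
      using \<gamma> by (auto simp: \<gamma>_eq mem_tuple_stabilizer)
    have "t (inv' \<sigma> k) = \<alpha> (inv g) (t k)" if k: "k \<in> {1..m}" for k
    proof -
      have k': "inv' \<sigma> k \<in> {1..m}" using k permutes_in_image[OF permutes_inv[OF \<sigma>]] by blast
      have "\<alpha> (inv g) (t k) = \<alpha> (inv g) (\<alpha> g (t (inv' \<sigma> k)))"
        using t[OF k'] permutes_inverses(1)[OF \<sigma>] by simp
      also have "\<dots> = \<alpha> (inv g \<otimes> g) (t (inv' \<sigma> k))" using g k' by (intro mult[symmetric]) auto
      finally show ?thesis using g k' one by simp
    qed
    moreover have "inv\<^bsub>?P\<^esub> \<gamma> = (inv g, inv' \<sigma>)"
      using g \<sigma> by (simp add: \<gamma>_eq inv_DirProd is_group sym_group_is_group sym_group_carrier)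
    ultimately show "inv\<^bsub>?P\<^esub> \<gamma> \<in> ?T" using g permutes_inv[OF \<sigma>] by (simp add: mem_tuple_stabilizer)
    fix \<delta> assume \<delta>: "\<delta> \<in> ?T"
    obtain h \<tau> where \<delta>_eq: "\<delta> = (h, \<tau>)" by (cases \<delta>)
    have h: "h \<in> A" and \<tau>: "\<tau> permutes {1..m}" and t': "\<And>k. k \<in> {1..m} \<Longrightarrow> t (\<tau> k) = \<alpha> h (t k)"
      using \<delta> by (auto simp: \<delta>_eq mem_tuple_stabilizer)
    have "t (\<sigma> (\<tau> k)) = \<alpha> (g \<otimes> h) (t k)" if k: "k \<in> {1..m}" for k
    proof -
      have "\<tau> k \<in> {1..m}" using k permutes_in_image[OF \<tau>] by blast
      then show ?thesis using t t'[OF k] mult[OF g h k] by simp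
    qed
    then show "\<gamma> \<otimes>\<^bsub>?P\<^esub> \<delta> \<in> ?T"
      using g h permutes_compose[OF \<tau> \<sigma>]
      by (simp add: \<gamma>_eq \<delta>_eq mem_tuple_stabilizer sym_group_mult)
  qed
qed

text \<open>The last hypothesis says that h^-1 g h = d lies in \<Lambda>; this form avoids computing
  inverses in the product group.\<close>

lemma act_homog_fixed:
  assumes \<Lambda>: "subgroup \<Lambda> G" and "g \<in> carrier G" and "h \<in> carrier G" and "d \<in> \<Lambda>"
    and "g \<otimes> h = h \<otimes> d"
  shows "act (homog G \<Lambda>) g (h <# \<Lambda>) = h <# \<Lambda>"
proof -
  have sub: "\<Lambda> \<subseteq> carrier G" by (rule subgroup.subset[OF \<Lambda>])
  have "act (homog G \<Lambda>) g (h <# \<Lambda>) = g <# (h <# \<Lambda>)"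
    using assms(3) by (intro act_homog) (auto simp: pts_homog)
  also have "\<dots> = h <# (d <# \<Lambda>)" using assms sub subsetD[OF sub \<open>d \<in> \<Lambda>\<close>] by (simp add: lcos_m_assoc)
  also have "d <# \<Lambda> = \<Lambda>" using assms sub by (intro coset_join3) auto
  finally show ?thesis .
qed

text \<open>Translates stabilizers of points of Z into \<open>tuple_stabilizer\<close>. Evaluating
  at \<sigma> k, respectively \<sigma>^-1 k, trades the inverse in the action for the plain
  equation.\<close>

lemma act_Z_gset_eq_iff:
  assumes x: "x \<in> pts (Z_gset G m L H)" and \<sigma>: "\<sigma> permutes {1..m}"
  shows "act (Z_gset G m L H) (g, \<sigma>) x = x \<longleftrightarrow> (\<forall>k\<in>{1..m}. x (\<sigma> k) = g <# x k)"
proof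
  assume eq: "act (Z_gset G m L H) (g, \<sigma>) x = x"
  show "\<forall>k\<in>{1..m}. x (\<sigma> k) = g <# x k"
  proof
    fix k assume "k \<in> {1..m}"
    then have "\<sigma> k \<in> {1..m}" using permutes_in_image[OF \<sigma>] by blast
    then show "x (\<sigma> k) = g <# x k"
      using fun_cong[OF eq, of "\<sigma> k"] permutes_inverses(2)[OF \<sigma>] by (simp add: act_Z_gset[OF x \<sigma>])
  qed
next
  assume eq: "\<forall>k\<in>{1..m}. x (\<sigma> k) = g <# x k"
  have "g <# x (inv' \<sigma> k) = x k" if k: "k \<in> {1..m}" for k
  proof -
    have "inv' \<sigma> k \<in> {1..m}" using k permutes_in_image[OF permutes_inv[OF \<sigma>]] by blast
    from bspec[OF eq this] show ?thesis using permutes_inverses(1)[OF \<sigma>] by simp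
  qed
  moreover have "x \<in> extensional {1..m}" using x by (auto simp: pts_Z_gset dest: fibre_powerD)
  ultimately show "act (Z_gset G m L H) (g, \<sigma>) x = x"
    by (intro extensionalityI[of _ "{1..m}"]) (auto simp: act_Z_gset[OF x \<sigma>])
qed

lemma l_coset_inj:
  assumes "g \<in> carrier G" and "C \<subseteq> carrier G" and "D \<subseteq> carrier G" and "g <# C = g <# D"
  shows "C = D"
proof -
  have "inv g <# (g <# C) = inv g <# (g <# D)" using assms(4) by simp
  then show ?thesis using assms(1-3) by (simp add: lcos_m_assoc lcos_mult_one)
qed

lemma cosets_in_eq: "cosets_in G S K = (\<lambda>s. s <# K) ` S"
  by (auto simp: cosets_in_def LCOSETS_def)

lemma cosets_in_closed:
  assumes S: "subgroup S G" and "K \<subseteq> carrier G" and "s \<in> S" and "C \<in> cosets_in G S K"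
  shows "s <# C \<in> cosets_in G S K"
  using assms subgroup.m_closed[OF S] subgroup.mem_carrier[OF S]
  by (auto simp: cosets_in_eq lcos_m_assoc)

lemma inj_on_l_coset_cosets_in:
  assumes S: "subgroup S G" and K: "K \<subseteq> carrier G" and s: "s \<in> S"
  shows "inj_on (\<lambda>C. s <# C) (cosets_in G S K)"
proof (rule inj_onI)
  fix C D assume "C \<in> cosets_in G S K" "D \<in> cosets_in G S K" and eq: "s <# C = s <# D"
  then have "C \<subseteq> carrier G" "D \<subseteq> carrier G"
    using l_coset_subset_G[OF K] subgroup.mem_carrier[OF S] by (auto simp: cosets_in_eq)
  with eq show "C = D" using l_coset_inj subgroup.mem_carrier[OF S s] by blast
qed

lemma wreath_preimage_eq_tuple_stabilizer:
  assumes S: "subgroup S G" and K: "K \<subseteq> carrier G"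
    and e: "bij_betw e {1..n} (cosets_in G S K)"
  shows "wreath_preimage q n (graph_subgroup G n e S)
    = tuple_stabilizer S (q * n) (\<lambda>g C. g <# C) (\<lambda>k. e (block q k))"
proof -
  note mem = mem_wreath_preimage_graph_subgroup[where G = G and S = S, OF e]
  show ?thesis
  proof (rule Set.set_eqI)
    fix \<gamma> :: "'a \<times> (nat \<Rightarrow> nat)"
    obtain s \<sigma> where \<gamma>: "\<gamma> = (s, \<sigma>)" by (cases \<gamma>)
    show "\<gamma> \<in> wreath_preimage q n (graph_subgroup G n e S) \<longleftrightarrow>
        \<gamma> \<in> tuple_stabilizer S (q * n) (\<lambda>g C. g <# C) (\<lambda>k. e (block q k))"
      unfolding \<gamma> mem_tuple_stabilizer
      by (rule mem) (use cosets_in_closed[OF S K] inj_on_l_coset_cosets_in[OF S K] in auto)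
  qed
qed

lemma subgroup_cosets_stabilizer:
  assumes "subgroup A G" and "\<And>k. k \<in> {1..m} \<Longrightarrow> t k \<subseteq> carrier G"
  shows "subgroup (tuple_stabilizer A m (\<lambda>g C. g <# C) t) (G \<times>\<times> sym_group m)"
  by (rule subgroup_tuple_stabilizer[OF assms(1)])
    (simp_all add: lcos_mult_one lcos_m_assoc assms(2) subgroup.mem_carrier[OF assms(1)])

lemma subgroup_young:
  assumes "subgroup A G"
  shows "subgroup (A \<times> young i j) (G \<times>\<times> sym_group (i + j))"
  unfolding young_eq_tuple_stabilizer by (rule subgroup_tuple_stabilizer[OF assms]) auto

lemma subgroup_wreath_preimage:
  assumes S: "subgroup S G" and K: "K \<subseteq> carrier G"
    and e: "bij_betw e {1..n} (cosets_in G S K)"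
  shows "subgroup (wreath_preimage q n (graph_subgroup G n e S)) (G \<times>\<times> sym_group (q * n))"
  unfolding wreath_preimage_eq_tuple_stabilizer[OF assms]
proof (rule subgroup_cosets_stabilizer[OF S])
  fix k assume "k \<in> {1..q * n}"
  then have "e (block q k) \<in> cosets_in G S K" using e block_offset_bounds(1) by (auto simp: bij_betw_def)
  then show "e (block q k) \<subseteq> carrier G"
    using l_coset_subset_G[OF K] subgroup.mem_carrier[OF S] by (auto simp: cosets_in_eq)
qed

end

section \<open>Tuples of H-cosets inside L: the two kinds of stabilizers\<close>

locale coset_tuple = group G for G (structure) +
  fixes H L m and y :: "nat \<Rightarrow> 'a set"
  assumes H: "subgroup H G" and L: "subgroup L G" and m: "m \<ge> 1"
    and y_coset: "\<And>k. k \<in> {1..m} \<Longrightarrow> y k \<in> lcosets H"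
    and y_subset: "\<And>k. k \<in> {1..m} \<Longrightarrow> y k \<subseteq> L"
begin

text \<open>The stabilizer is taken in all of G x \<Sigma>_m, as the criterion for points of Z
  requires; that its projection S lies in L is then a consequence of the position of the
  entries.\<close>

definition T where "T = tuple_stabilizer (carrier G) m (\<lambda>g C. g <# C) y"
definition S where "S = fst ` T"

lemma y_carrier: "k \<in> {1..m} \<Longrightarrow> y k \<subseteq> carrier G"
  using y_subset subgroup.subset[OF L] by blast

lemma one_mem: "1 \<in> {1..m}"
  using m by simp

lemma subgroup_S: "subgroup S G"
proof -
  interpret P: group_hom "G \<times>\<times> sym_group m" G fst
    by (simp add: group_hom_def group_hom_axioms_def is_group group_prod hom_def mult_DirProd' Pi_iff)
  show ?thesis unfolding S_def T_def
    by (rule P.subgroup_img_is_subgroup) (auto intro!: subgroup_cosets_stabilizer subgroup_self y_carrier)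
qed

lemma S_permutes_entries:
  assumes "s \<in> S"
  obtains \<sigma> where "\<sigma> permutes {1..m}" and "\<And>k. k \<in> {1..m} \<Longrightarrow> y (\<sigma> k) = s <# y k"
  using assms by (auto simp: S_def T_def mem_tuple_stabilizer)

text \<open>An element s of S moves a member a of the first entry into another entry. All entries
  lie in L, so a and s a are in L, hence also s.\<close>

lemma S_subset: "S \<subseteq> L"
proof
  fix s assume s: "s \<in> S"
  then obtain \<sigma> where \<sigma>: "\<sigma> permutes {1..m}" and y: "\<And>k. k \<in> {1..m} \<Longrightarrow> y (\<sigma> k) = s <# y k"
    by (rule S_permutes_entries) blast
  obtain a where a: "a \<in> carrier G" "y 1 = a <# H"
    using y_coset[OF one_mem] by (auto simp: LCOSETS_def)
  have "a \<in> y 1" using a lcos_self[OF _ H] by simp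
  then have aL: "a \<in> L" using y_subset[OF one_mem] by blast
  have "s \<otimes> a \<in> y (\<sigma> 1)" using y[OF one_mem] \<open>a \<in> y 1\<close> by (auto simp: l_coset_def)
  moreover have "\<sigma> 1 \<in> {1..m}" using one_mem permutes_in_image[OF \<sigma>] by blast
  ultimately have "s \<otimes> a \<in> L" using y_subset by blast
  then have "(s \<otimes> a) \<otimes> inv a \<in> L" using aL L by (auto intro: subgroup.m_closed subgroup.m_inv_closed)
  then show "s \<in> L" using a subgroup.mem_carrier[OF subgroup_S s] by (simp add: m_assoc)
qed

definition transitive where
  "transitive \<longleftrightarrow> (\<forall>k\<in>{1..m}. \<exists>s\<in>S. y k = s <# y 1)"

text \<open>Membership of the entry in the S-orbit of \<open>y 1\<close> is an invariant
  two-colouring of the positions. Both colours occur, the second by failure of transitivity. Sorting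
  the i positions of the first colour to the front by \<sigma>0 turns the colouring into
  \<open>k \<le> i\<close>, whose stabilizer is known.\<close>

lemma young_case:
  assumes "\<not> transitive"
  obtains i j \<sigma>0 where "i + j = m" and "0 < i" and "0 < j" and "\<sigma>0 permutes {1..m}"
    and "\<And>g \<sigma>. (g, \<sigma>) \<in> T \<Longrightarrow> (g, inv' \<sigma>0 \<circ> \<sigma> \<circ> \<sigma>0) \<in> L \<times> young i j"
proof -
  define F where "F C \<longleftrightarrow> (\<exists>s\<in>S. C = s <# y 1)" for C
  define i j where "i = card {k \<in> {1..m}. F (y k)}" and "j = card {k \<in> {1..m}. \<not> F (y k)}"
  have "{1..m} = {k \<in> {1..m}. F (y k)} \<union> {k \<in> {1..m}. \<not> F (y k)}" by auto
  then have "card {1..m} = i + j" unfolding i_def j_def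
    by (metis (no_types, lifting) card_Un_disjoint disjoint_iff finite_Un finite_atLeastAtMost mem_Collect_eq)
  then have ij: "i + j = m" by simp
  have "F (y 1)"
    using subgroup.one_closed[OF subgroup_S] lcos_mult_one[OF y_carrier[OF one_mem]] by (force simp: F_def)
  then have "1 \<in> {k \<in> {1..m}. F (y k)}" using one_mem by simp
  then have "0 < i" unfolding i_def card_gt_0_iff by auto
  moreover obtain k where "k \<in> {1..m}" "\<not> F (y k)" using assms by (auto simp: transitive_def F_def)
  then have "0 < j" unfolding j_def card_gt_0_iff by auto
  moreover obtain \<sigma>0 where \<sigma>0: "\<sigma>0 permutes {1..m}"
    and F\<sigma>0: "\<And>k. k \<in> {1..m} \<Longrightarrow> F (y (\<sigma>0 k)) = (k \<le> i)"
  proof (rule exists_permutation_matching_fibres[of "{1..m}" "\<lambda>k. F (y k)" "\<lambda>k. k \<le> i"])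
    fix c
    have "{k \<in> {1..m}. k \<le> i} = {1..i}" "{k \<in> {1..m}. \<not> k \<le> i} = {i + 1..i + j}" using ij by auto
    then show "card {k \<in> {1..m}. F (y k) = c} = card {k \<in> {1..m}. (k \<le> i) = c}"
      by (cases c) (simp_all add: i_def j_def)
  qed auto
  moreover have "(g, inv' \<sigma>0 \<circ> \<sigma> \<circ> \<sigma>0) \<in> L \<times> young i j" if g\<sigma>: "(g, \<sigma>) \<in> T" for g \<sigma>
  proof -
    have g: "g \<in> S" using g\<sigma> by (force simp: S_def)
    have gc: "g \<in> carrier G" by (rule subgroup.mem_carrier[OF subgroup_S g])
    \<comment> \<open>Since g lies in the group S, it preserves the orbit and its complement; this
      is equivariance of F for the trivial action on Booleans.\<close>
    have "F (g <# y k) = F (y k)" if k: "k \<in> {1..m}" for k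
    proof
      assume "F (y k)"
      then obtain s where s: "s \<in> S" "y k = s <# y 1" by (auto simp: F_def)
      then have "g <# y k = (g \<otimes> s) <# y 1"
        using gc subgroup.mem_carrier[OF subgroup_S] y_carrier[OF one_mem] by (simp add: lcos_m_assoc)
      then show "F (g <# y k)" using subgroup.m_closed[OF subgroup_S g s(1)] by (auto simp: F_def)
    next
      assume "F (g <# y k)"
      then obtain s where s: "s \<in> S" "g <# y k = s <# y 1" by (auto simp: F_def)
      have "y k = inv g <# (g <# y k)"
        using gc y_carrier[OF k] by (simp add: lcos_m_assoc lcos_mult_one)
      also have "\<dots> = (inv g \<otimes> s) <# y 1"
        using s gc subgroup.mem_carrier[OF subgroup_S] y_carrier[OF one_mem] by (simp add: lcos_m_assoc)
      finally show "F (y k)"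
        using subgroup.m_closed[OF subgroup_S subgroup.m_inv_closed[OF subgroup_S g] s(1)]
        by (auto simp: F_def)
    qed
    then show ?thesis
      unfolding young_eq_tuple_stabilizer ij
      using \<sigma>0 F\<sigma>0 g\<sigma> g S_subset
      by (intro conjugate_tuple_stabilizer[where F = F and y = y and A = "carrier G"
            and \<alpha> = "l_coset G"]) (auto simp: T_def)
  qed
  ultimately show ?thesis using that ij by blast
qed

text \<open>K is the stabilizer of \<open>y 1\<close> in S, and transitivity identifies the entries
  with S/K. The ordering e is quantified after K because an ordering is prescribed for each pair (S,
  K), and K becomes known only here.\<close>

lemma wreath_case:
  assumes tra: transitive and fin: "finite (carrier G)"
    and nonconst: "\<exists>k\<in>{1..m}. y k \<noteq> y 1"
  obtains K where "subgroup K G" and "K \<subset> S"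
    and "\<forall>e n. n = card (cosets_in G S K) \<longrightarrow> bij_betw e {1..n} (cosets_in G S K) \<longrightarrow>
      n \<noteq> 1 \<and> (\<exists>q \<sigma>0. m = n * q \<and> \<sigma>0 permutes {1..m} \<and>
        (\<forall>g \<sigma>. (g, \<sigma>) \<in> T \<longrightarrow> (g, inv' \<sigma>0 \<circ> \<sigma> \<circ> \<sigma>0) \<in> wreath_preimage q n (graph_subgroup G n e S)))"
proof -
  note SG = subgroup_S and Sc = subgroup.mem_carrier[OF subgroup_S]
  note y1 = y_carrier[OF one_mem]
  \<comment> \<open>Inverse of the identification of sK with the entry s \<open>y 1\<close>: an
    entry goes to the coset of all elements of S that carry \<open>y 1\<close> to it.\<close>
  define F where "F C = {s \<in> S. s <# y 1 = C}" for C
  define K where "K = F (y 1)"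
  have K: "subgroup K G"
  proof (rule subgroupI)
    show "K \<subseteq> carrier G" using Sc by (auto simp: K_def F_def)
    have "\<one> \<in> K" using subgroup.one_closed[OF SG] lcos_mult_one[OF y1] by (simp add: K_def F_def)
    then show "K \<noteq> {}" by blast
    show "a \<otimes> b \<in> K" if "a \<in> K" "b \<in> K" for a b
      using that subgroup.m_closed[OF SG] Sc y1 by (simp add: K_def F_def flip: lcos_m_assoc)
    show "inv a \<in> K" if "a \<in> K" for a
    proof -
      have a: "a \<in> S" "a <# y 1 = y 1" using that by (auto simp: K_def F_def)
      have "inv a <# (a <# y 1) = y 1" using Sc[OF a(1)] y1 by (simp add: lcos_m_assoc lcos_mult_one)
      then show ?thesis using a subgroup.m_inv_closed[OF SG] by (simp add: K_def F_def)
    qed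
  qed
  have Kc: "K \<subseteq> carrier G" by (rule subgroup.subset[OF K])
  have F_S: "F (s <# y 1) = s <# K" if s: "s \<in> S" for s
  proof (intro equalityI subsetI)
    fix t assume "t \<in> F (s <# y 1)"
    then have t: "t \<in> S" "t <# y 1 = s <# y 1" by (auto simp: F_def)
    have "(inv s \<otimes> t) <# y 1 = inv s <# (s <# y 1)"
      using t Sc s y1 by (simp flip: lcos_m_assoc)
    then have "inv s \<otimes> t \<in> K"
      using Sc[OF s] y1 subgroup.m_closed[OF SG subgroup.m_inv_closed[OF SG s] t(1)]
      by (simp add: K_def F_def lcos_m_assoc lcos_mult_one)
    moreover have "t = s \<otimes> (inv s \<otimes> t)" using Sc[OF s] Sc[OF t(1)] by (simp flip: m_assoc)
    ultimately show "t \<in> s <# K" by (auto simp: l_coset_def)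
  next
    fix t assume "t \<in> s <# K"
    then obtain k where k: "k \<in> S" "k <# y 1 = y 1" "t = s \<otimes> k" by (auto simp: l_coset_def K_def F_def)
    then show "t \<in> F (s <# y 1)"
      using subgroup.m_closed[OF SG s k(1)] Sc[OF s] Sc[OF k(1)] y1 by (simp add: F_def flip: lcos_m_assoc)
  qed
  have F_eq: "F (y k) = s <# K \<longleftrightarrow> y k = s <# y 1" if k: "k \<in> {1..m}" and s: "s \<in> S" for k s
  proof
    assume "F (y k) = s <# K"
    then have "s \<in> F (y k)" using lcos_self[OF Sc[OF s] K] by simp
    then show "y k = s <# y 1" by (simp add: F_def)
  qed (simp only: F_S[OF s])
  have F_mem: "F (y k) \<in> cosets_in G S K" if k: "k \<in> {1..m}" for k
  proof -
    obtain s where s: "s \<in> S" "y k = s <# y 1" using tra k unfolding transitive_def by blast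
    have "F (y k) = s <# K" unfolding s(2) by (rule F_S[OF s(1)])
    then show ?thesis using s(1) by (auto simp: cosets_in_eq)
  qed
  have "K \<subset> S"
  proof
    show "K \<subseteq> S" by (auto simp: K_def F_def)
    obtain k where k: "k \<in> {1..m}" "y k \<noteq> y 1" using nonconst by blast
    then obtain s where "s \<in> S" "y k = s <# y 1" using tra unfolding transitive_def by blast
    then have "s \<notin> K" using k by (auto simp: K_def F_def)
    with \<open>s \<in> S\<close> show "K \<noteq> S" by blast
  qed
  moreover have "n \<noteq> 1 \<and> (\<exists>q \<sigma>0. m = n * q \<and> \<sigma>0 permutes {1..m} \<and>
        (\<forall>g \<sigma>. (g, \<sigma>) \<in> T \<longrightarrow> (g, inv' \<sigma>0 \<circ> \<sigma> \<circ> \<sigma>0) \<in> wreath_preimage q n (graph_subgroup G n e S)))"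
    if n: "n = card (cosets_in G S K)" and e: "bij_betw e {1..n} (cosets_in G S K)" for e n
  proof -
    have finS: "finite S" using fin subgroup.subset[OF SG] by (rule finite_subset[rotated])
    have finC: "finite (cosets_in G S K)" using finS by (simp add: cosets_in_eq)
    define q where "q = card {k \<in> {1..m}. y k = y 1}"
    \<comment> \<open>The permutation that realizes s carries the positions with entry
      \<open>y 1\<close> bijectively to those with entry s \<open>y 1\<close>, so every fibre has
      the size of the first.\<close>
    have fibre: "card {k \<in> {1..m}. F (y k) = C} = q" if C: "C \<in> cosets_in G S K" for C
    proof -
      obtain s where s: "s \<in> S" "C = s <# K" using C by (auto simp: cosets_in_eq)
      obtain \<sigma> where \<sigma>: "\<sigma> permutes {1..m}" and y: "\<And>k. k \<in> {1..m} \<Longrightarrow> y (\<sigma> k) = s <# y k"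
        using s(1) by (rule S_permutes_entries) blast
      have "{k \<in> {1..m}. F (y k) = C} = {k \<in> {1..m}. y k = s <# y 1}" using F_eq s by auto
      also have "\<dots> = \<sigma> ` {k \<in> {1..m}. y k = y 1}"
      proof (intro equalityI subsetI)
        fix k assume "k \<in> {k \<in> {1..m}. y k = s <# y 1}"
        then have k: "k \<in> {1..m}" "y k = s <# y 1" by auto
        have k': "inv' \<sigma> k \<in> {1..m}" using k permutes_in_image[OF permutes_inv[OF \<sigma>]] by blast
        have "s <# y (inv' \<sigma> k) = s <# y 1"
          using y[OF k'] k(2) permutes_inverses(1)[OF \<sigma>] by simp
        then have "y (inv' \<sigma> k) = y 1" by (rule l_coset_inj[OF Sc[OF s(1)] y_carrier[OF k'] y1])
        then show "k \<in> \<sigma> ` {k \<in> {1..m}. y k = y 1}"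
          using k' permutes_inverses(1)[OF \<sigma>, of k] by (intro image_eqI[of _ _ "inv' \<sigma> k"]) auto
      next
        fix k assume "k \<in> \<sigma> ` {k \<in> {1..m}. y k = y 1}"
        then obtain l where l: "l \<in> {1..m}" "y l = y 1" "k = \<sigma> l" by blast
        have "\<sigma> l \<in> {1..m}" using l(1) permutes_in_image[OF \<sigma>] by blast
        then show "k \<in> {k \<in> {1..m}. y k = s <# y 1}" using y[OF l(1)] l by simp
      qed
      finally show ?thesis
        unfolding q_def by (simp add: card_image inj_on_subset[OF permutes_inj[OF \<sigma>]])
    qed
    have im: "(\<lambda>k. F (y k)) ` {1..m} \<subseteq> cosets_in G S K" using F_mem by blast
    \<comment> \<open>The positions are counted along the fibres of
      \<open>\<lambda>k. F (y k)\<close>, which are indexed by the n cosets of K in S.\<close>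
    have "card {1..m} = (\<Sum>C\<in>cosets_in G S K. card {k \<in> {1..m}. F (y k) = C})"
      using sum.group[OF _ finC im, of "\<lambda>_. 1::nat"] by simp
    also have "\<dots> = n * q" using fibre by (simp add: n)
    finally have mnq: "m = n * q" by simp
    have "n \<noteq> 1"
    proof
      assume "n = 1"
      then obtain C where C: "cosets_in G S K = {C}" using n by (auto simp: card_1_singleton_iff)
      have "s \<in> K" if s: "s \<in> S" for s
      proof -
        have "s <# K = \<one> <# K"
          using C s subgroup.one_closed[OF SG] unfolding cosets_in_eq by blast
        then show ?thesis using lcos_self[OF Sc[OF s] K] lcos_mult_one[OF Kc] by simp
      qed
      with \<open>K \<subset> S\<close> show False by blast
    qed
    \<comment> \<open>Both functions take each coset in S/K exactly q times and no other
      value.\<close>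
    moreover obtain \<sigma>0 where \<sigma>0: "\<sigma>0 permutes {1..m}"
      and F\<sigma>0: "\<And>k. k \<in> {1..m} \<Longrightarrow> F (y (\<sigma>0 k)) = e (block q k)"
    proof (rule exists_permutation_matching_fibres[of "{1..m}" "\<lambda>k. F (y k)" "\<lambda>k. e (block q k)"])
      fix C
      have m': "{1..m} = {1..q * n}" using mnq by (simp add: mult.commute)
      show "card {k \<in> {1..m}. F (y k) = C} = card {k \<in> {1..m}. e (block q k) = C}"
      proof (cases "C \<in> cosets_in G S K")
        case True
        then have "C \<in> e ` {1..n}" using e by (simp add: bij_betw_def)
        then obtain b where b: "b \<in> {1..n}" "e b = C" by blast
        have "e (block q k) = C \<longleftrightarrow> block q k = b" if "k \<in> {1..q * n}" for k
          using e b block_offset_bounds(1)[OF that] by (auto simp: bij_betw_def dest: inj_onD)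
        then have "{k \<in> {1..m}. e (block q k) = C} = {k \<in> {1..q * n}. block q k = b}"
          unfolding m' by blast
        then show ?thesis using fibre[OF True] card_block[OF b(1)] by simp
      next
        case False
        have "e (block q k) \<in> cosets_in G S K" if "k \<in> {1..m}" for k
          using e block_offset_bounds(1) that unfolding m' by (auto simp: bij_betw_def)
        then have "{k \<in> {1..m}. F (y k) = C} = {}" "{k \<in> {1..m}. e (block q k) = C} = {}"
          using False F_mem by blast+
        then show ?thesis by (simp only:)
      qed
    qed auto
    moreover have "(g, inv' \<sigma>0 \<circ> \<sigma> \<circ> \<sigma>0) \<in> wreath_preimage q n (graph_subgroup G n e S)"
      if g\<sigma>: "(g, \<sigma>) \<in> T" for g \<sigma>
    proof -
      have g: "g \<in> S" using g\<sigma> by (force simp: S_def)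
      \<comment> \<open>F carries left multiplication on entries to left multiplication on S/K, the
        equivariance that \<open>conjugate_tuple_stabilizer\<close> asks for.\<close>
      have "F (g <# y k) = g <# F (y k)" if k: "k \<in> {1..m}" for k
      proof -
        obtain s where s: "s \<in> S" "y k = s <# y 1" using tra k unfolding transitive_def by blast
        have "g <# y k = (g \<otimes> s) <# y 1" using s g Sc y1 by (simp add: lcos_m_assoc)
        then have "F (g <# y k) = (g \<otimes> s) <# K"
          using F_S subgroup.m_closed[OF SG g s(1)] by simp
        then show ?thesis using s g Sc Kc F_S by (simp add: lcos_m_assoc)
      qed
      moreover have "q * n = m" using mnq by (simp add: mult.commute)
      ultimately show ?thesis
        unfolding wreath_preimage_eq_tuple_stabilizer[OF SG Kc e]
        using \<sigma>0 F\<sigma>0 g\<sigma> g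
        by (intro conjugate_tuple_stabilizer[where F = F and y = y and A = "carrier G"
              and \<alpha> = "l_coset G"]) (auto simp: T_def)
    qed
    ultimately show ?thesis using mnq by blast
  qed
  ultimately show ?thesis by (intro that[OF K]) blast+
qed

end

section \<open>Comparison of the two ideals\<close>

lemma finsum_single:
  assumes "abelian_group A" and "finite D" and "d \<in> D" and "f d \<in> carrier A"
    and "\<And>c. \<lbrakk>c \<in> D; c \<noteq> d\<rbrakk> \<Longrightarrow> f c = \<zero>\<^bsub>A\<^esub>"
  shows "finsum A f D = f d"
proof -
  interpret A: abelian_group A by fact
  have "finsum A f (insert d (D - {d})) = f d \<oplus>\<^bsub>A\<^esub> finsum A f (D - {d})"
    by (rule A.finsum_insert) (use assms in \<open>auto simp: Pi_iff\<close>)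
  also have "finsum A f (D - {d}) = \<zero>\<^bsub>A\<^esub>" by (rule A.add.finprod_one_eqI) (use assms in auto)
  finally show ?thesis using assms by (simp add: insert_absorb)
qed

section \<open>Images of the transfers to G/L\<close>

locale product_mackey = group G + R: mackey_functor "G \<times>\<times> sym_group m" R
  for G :: "('g, 'c) monoid_scheme" (structure) and m :: nat
    and R :: "('g \<times> (nat \<Rightarrow> nat), 'g point, 'r) mackey" +
  fixes L
  assumes fin: "finite (carrier G)" and L: "subgroup L G" and m: "m \<ge> 1"
begin

abbreviation P where "P \<equiv> G \<times>\<times> sym_group m"
abbreviation B where "B \<equiv> triv (base G L)"
abbreviation orbit_gset where "orbit_gset \<Lambda> \<equiv> embed GSCoset (homog P \<Lambda>)"
abbreviation orbit_map where
  "orbit_map \<Lambda> \<equiv> embed_map GSCoset GCoset (homog P \<Lambda>) (coset_proj G L)"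
abbreviation Z where "Z H \<equiv> Z_gset G m L H"
abbreviation Z_map where "Z_map H \<equiv> embed_map Tuple GCoset (Z H) (fibre_proj G L)"

lemma finite_B: "finite_gset P B"
  by (rule finite_gset_base[OF fin L])

lemma orbit_gset_props:
  assumes "\<Lambda> \<subseteq> L \<times> carrier (sym_group m)" and "\<Lambda> \<noteq> {}"
  shows "finite_gset P (orbit_gset \<Lambda>)" and "gmap P (orbit_gset \<Lambda>) B (orbit_map \<Lambda>)"
proof -
  show "finite_gset P (orbit_gset \<Lambda>)"
    by (rule finite_gset_orbit[OF fin]) (use assms(1) subgroup.subset[OF L] in auto)
  show "gmap P (orbit_gset \<Lambda>) B (orbit_map \<Lambda>)" by (rule gmap_coset_proj[OF fin L assms])
qed

lemma Z_props:
  assumes "subgroup H G" and "H \<subseteq> L"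
  shows "finite_gset P (embed Tuple (Z H))" and "gmap P (embed Tuple (Z H)) B (Z_map H)"
  using finite_gset_embed[OF finite_gset_Z_gset[OF fin assms(1) L], of Tuple]
    gmap_fibre_proj[OF fin assms(1) L assms(2) m] by (simp_all add: inj_on_def)

lemma orbit_tr_eq: "orbit_tr G m R L \<Lambda> = tr R (orbit_gset \<Lambda>) B (orbit_map \<Lambda>)"
  by (simp add: orbit_tr_def tr_to_base_def)

lemma young_subset:
  assumes "i + j = m"
  shows "L \<times> young i j \<subseteq> L \<times> carrier (sym_group m)" and "L \<times> young i j \<noteq> {}"
proof -
  show "L \<times> young i j \<subseteq> L \<times> carrier (sym_group m)"
    using assms by (auto simp: young_iff sym_group_carrier)
  show "L \<times> young i j \<noteq> {}"
    using subgroup.one_closed[OF subgroup_young[OF L, of i j]] by blast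
qed

lemma I_Tr_subset_carrier: "I_Tr G m R L \<subseteq> carrier (obj R B)"
proof
  interpret B: abelian_group "obj R B" by (rule R.obj_abelian_group[OF finite_B])
  let ?D = "{(i, j). i + j = m \<and> 0 < i \<and> 0 < j}"
  fix a assume "a \<in> I_Tr G m R L"
  then obtain x where
    a: "a = finsum (obj R B) (\<lambda>(i, j). orbit_tr G m R L (L \<times> young i j) (x (i, j))) ?D"
    and x: "\<forall>(i, j)\<in>?D. x (i, j) \<in> carrier (orbit_level G m R (L \<times> young i j))"
    by (auto simp: I_Tr_def Let_def induced_def)
  show "a \<in> carrier (obj R B)" unfolding a
  proof (rule B.finsum_closed, rule Pi_I)
    fix c assume c: "c \<in> ?D"
    obtain i j where c_eq: "c = (i, j)" by (cases c)
    have ij: "i + j = m" "0 < i" "0 < j" using c by (auto simp: c_eq)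
    then have "x (i, j) \<in> carrier (obj R (orbit_gset (L \<times> young i j)))"
      using x by (auto simp: orbit_level_def)
    then have "orbit_tr G m R L (L \<times> young i j) (x (i, j)) \<in> carrier (obj R B)"
      unfolding orbit_tr_eq using ij(1)
      by (intro R.tr_closed finite_B orbit_gset_props young_subset)
    then show "(\<lambda>(i, j). orbit_tr G m R L (L \<times> young i j) (x (i, j))) c \<in> carrier (obj R B)"
      by (simp add: c_eq)
  qed
qed

text \<open>\<open>I_Tr\<close> is made of sums over all decompositions i + j = m at once, so a
  single transfer has to be completed by zeros in the other components.\<close>

lemma young_image_subset_I_Tr:
  assumes ij: "i + j = m" "0 < i" "0 < j"
  shows "orbit_tr G m R L (L \<times> young i j) ` carrier (orbit_level G m R (L \<times> young i j)) \<subseteq> I_Tr G m R L"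
proof
  let ?D = "{(i, j). i + j = m \<and> 0 < i \<and> 0 < j}"
  fix b assume "b \<in> orbit_tr G m R L (L \<times> young i j) ` carrier (orbit_level G m R (L \<times> young i j))"
  then obtain a where a: "a \<in> carrier (orbit_level G m R (L \<times> young i j))"
    and b: "b = orbit_tr G m R L (L \<times> young i j) a" by blast
  \<comment> \<open>Each pair (k, l) has its own level, so the default value is the zero of that
    level.\<close>
  define x where "x = (\<lambda>(k, l). if (k, l) = (i, j) then a
    else \<zero>\<^bsub>obj R (orbit_gset (L \<times> young k l))\<^esub>)"
  have x: "\<forall>(k, l)\<in>?D. x (k, l) \<in> carrier (orbit_level G m R (L \<times> young k l))"
  proof
    fix c assume c: "c \<in> ?D"
    obtain k l where c_eq: "c = (k, l)" by (cases c)
    interpret C: abelian_group "obj R (orbit_gset (L \<times> young k l))"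
      using c by (intro R.obj_abelian_group orbit_gset_props young_subset) (auto simp: c_eq)
    show "case c of (k, l) \<Rightarrow> x (k, l) \<in> carrier (orbit_level G m R (L \<times> young k l))"
      using a by (simp add: c_eq x_def orbit_level_def)
  qed
  let ?f = "\<lambda>(k, l). orbit_tr G m R L (L \<times> young k l) (x (k, l))"
  have "finsum (obj R B) ?f ?D = ?f (i, j)"
  proof (rule finsum_single[OF R.obj_abelian_group[OF finite_B]])
    show "finite ?D" by (rule finite_subset[of _ "{..m} \<times> {..m}"]) auto
    show "(i, j) \<in> ?D" using ij by simp
    have "tr R (orbit_gset (L \<times> young i j)) B (orbit_map (L \<times> young i j)) a \<in> carrier (obj R B)"
      using a ij(1) unfolding orbit_level_def
      by (intro R.tr_closed finite_B orbit_gset_props young_subset)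
    then show "?f (i, j) \<in> carrier (obj R B)" by (simp add: x_def orbit_tr_eq)
    fix c assume c: "c \<in> ?D" "c \<noteq> (i, j)"
    obtain k l where kl: "c = (k, l)" by (cases c)
    have "tr R (orbit_gset (L \<times> young k l)) B (orbit_map (L \<times> young k l))
        \<zero>\<^bsub>obj R (orbit_gset (L \<times> young k l))\<^esub> = \<zero>\<^bsub>obj R B\<^esub>"
      using c kl by (intro R.tr_zero finite_B orbit_gset_props young_subset) auto
    then show "?f c = \<zero>\<^bsub>obj R B\<^esub>" using c by (auto simp: kl x_def orbit_tr_eq)
  qed
  then have "b = finsum (obj R B) ?f ?D" by (simp add: b x_def)
  with x show "b \<in> I_Tr G m R L" unfolding I_Tr_def Let_def induced_def by auto
qed

text \<open>Supplies the data that \<open>tr_image_subset_if_stabilizers\<close> asks for at the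
  point y: the orbit of \<Lambda> with the point w = (1, \<sigma>0)\<Lambda>. An element (g,
  \<sigma>) fixes w because its conjugate by (1, \<sigma>0) lies in \<Lambda>, and w lies over the
  coset L just as y does.\<close>

lemma fixes_orbit_witness:
  assumes H: "subgroup H G" "H \<subseteq> L"
    and \<Lambda>: "subgroup \<Lambda> P" "\<Lambda> \<subseteq> L \<times> carrier (sym_group m)"
    and \<sigma>0: "\<sigma>0 permutes {1..m}" and y: "y \<in> pts (Z H)" "y 1 <#> L = L"
    and T: "\<And>g \<sigma>. (g, \<sigma>) \<in> tuple_stabilizer (carrier G) m (\<lambda>g C. g <# C) y
      \<Longrightarrow> (g, inv' \<sigma>0 \<circ> \<sigma> \<circ> \<sigma>0) \<in> \<Lambda>"
    and I: "orbit_tr G m R L \<Lambda> ` carrier (orbit_level G m R \<Lambda>) \<subseteq> I"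
  shows "\<exists>Y h. \<exists>w\<in>pts Y. finite_gset P Y \<and> gmap P Y B h \<and>
      h w = Z_map H (Tuple y) \<and> tr R Y B h ` carrier (obj R Y) \<subseteq> I \<and>
      (\<forall>\<gamma>\<in>carrier P. act (embed Tuple (Z H)) \<gamma> (Tuple y) = Tuple y \<longrightarrow> act Y \<gamma> w = w)"
proof -
  have ne: "\<Lambda> \<noteq> {}" using subgroup.one_closed[OF \<Lambda>(1)] by blast
  have \<gamma>0: "(\<one>, \<sigma>0) \<in> carrier P" using \<sigma>0 by (simp add: sym_group_carrier)
  let ?w = "(\<one>, \<sigma>0) <#\<^bsub>P\<^esub> \<Lambda>"
  have w: "?w \<in> pts (homog P \<Lambda>)" using \<gamma>0 by (auto simp: R.pts_homog)
  have injs: "inj_on GSCoset A" "inj_on Tuple A'" for A A' by (simp_all add: inj_on_def)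
  have "orbit_map \<Lambda> (GSCoset ?w) = Z_map H (Tuple y)"
    using coset_proj_l_coset[OF \<gamma>0 \<Lambda>(2) ne L] lcos_mult_one[OF subgroup.subset[OF L]] y
    by (simp add: embed_map_apply[OF injs(1) w] embed_map_apply[OF injs(2) y(1)] fibre_proj_def)
  moreover have "act (orbit_gset \<Lambda>) \<gamma> (GSCoset ?w) = GSCoset ?w"
    if \<gamma>: "\<gamma> \<in> carrier P" and fixed: "act (embed Tuple (Z H)) \<gamma> (Tuple y) = Tuple y" for \<gamma>
  proof -
    obtain g \<sigma> where g\<sigma>: "\<gamma> = (g, \<sigma>)" and g: "g \<in> carrier G" and \<sigma>: "\<sigma> permutes {1..m}"
      using \<gamma> by (auto simp: sym_group_carrier)
    have "act (Z H) (g, \<sigma>) y = y" using fixed by (simp add: act_embed[OF injs(2) y(1)] g\<sigma>)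
    then have "(g, inv' \<sigma>0 \<circ> \<sigma> \<circ> \<sigma>0) \<in> \<Lambda>"
      using g \<sigma> act_Z_gset_eq_iff[OF y(1) \<sigma>] by (intro T) (simp add: mem_tuple_stabilizer)
    moreover have "\<sigma>0 \<circ> (inv' \<sigma>0 \<circ> \<sigma> \<circ> \<sigma>0) = \<sigma> \<circ> \<sigma>0"
      by (simp add: permutes_inv_o(1)[OF \<sigma>0] flip: o_assoc) (simp add: o_assoc permutes_inv_o(1)[OF \<sigma>0])
    then have "\<gamma> \<otimes>\<^bsub>P\<^esub> (\<one>, \<sigma>0) = (\<one>, \<sigma>0) \<otimes>\<^bsub>P\<^esub> (g, inv' \<sigma>0 \<circ> \<sigma> \<circ> \<sigma>0)"
      using g by (simp add: g\<sigma> sym_group_mult)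
    ultimately have "act (homog P \<Lambda>) \<gamma> ?w = ?w" by (rule R.act_homog_fixed[OF \<Lambda>(1) \<gamma> \<gamma>0])
    then show ?thesis by (simp add: act_embed[OF injs(1) w])
  qed
  ultimately show ?thesis
    using orbit_gset_props[OF \<Lambda>(2) ne] w I
    by (intro exI[of _ "orbit_gset \<Lambda>"] exI[of _ "orbit_map \<Lambda>"] bexI[of _ "GSCoset ?w"])
      (auto simp: orbit_tr_eq orbit_level_def)
qed

lemma wreath_subset:
  assumes S: "subgroup S G" "S \<subseteq> L" and K: "K \<subseteq> carrier G"
    and e: "bij_betw e {1..n} (cosets_in G S K)" and mnq: "m = n * q"
  shows "wreath_preimage q n (graph_subgroup G n e S) \<subseteq> L \<times> carrier (sym_group m)"
    and "subgroup (wreath_preimage q n (graph_subgroup G n e S)) P"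
proof -
  have m': "q * n = m" using mnq by (simp add: mult.commute)
  show "wreath_preimage q n (graph_subgroup G n e S) \<subseteq> L \<times> carrier (sym_group m)"
    unfolding wreath_preimage_eq_tuple_stabilizer[OF S(1) K e] m'
    using S(2) by (auto simp: tuple_stabilizer_def sym_group_carrier)
  show "subgroup (wreath_preimage q n (graph_subgroup G n e S)) P"
    using subgroup_wreath_preimage[OF S(1) K e, of q] by (simp add: m')
qed

text \<open>Each point of Z is moved to one over the coset L, where transitivity of its group S
  decides between the two kinds of generators. Closure of I under sums joins the contributions of
  the different orbits.\<close>

lemma Z_image_subset:
  assumes HL: "subgroup H G" "H \<subseteq> L"
    and zero: "\<zero>\<^bsub>obj R B\<^esub> \<in> I" and add: "\<And>a b. \<lbrakk>a \<in> I; b \<in> I\<rbrakk> \<Longrightarrow> a \<oplus>\<^bsub>obj R B\<^esub> b \<in> I"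
    and I_Tr: "I_Tr G m R L \<subseteq> I"
    and e: "\<And>S K. \<lbrakk>subgroup S G; subgroup K G; K \<subset> S; S \<subseteq> L\<rbrakk>
          \<Longrightarrow> bij_betw (e S K) {1..card (cosets_in G S K)} (cosets_in G S K)"
    and wreath: "\<And>n q S K. \<lbrakk>m = n * q; subgroup S G; subgroup K G; K \<subset> S; S \<subseteq> L;
        card (cosets_in G S K) = n; n \<noteq> 1\<rbrakk> \<Longrightarrow>
      orbit_tr G m R L (wreath_preimage q n (graph_subgroup G n (e S K) S))
        ` carrier (orbit_level G m R (wreath_preimage q n (graph_subgroup G n (e S K) S))) \<subseteq> I"
  shows "tr_to_base G R L Tuple (Z H) (fibre_proj G L) ` carrier (obj R (embed Tuple (Z H))) \<subseteq> I"
  unfolding tr_to_base_def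
proof (rule R.tr_image_subset_if_stabilizers[OF Z_props(1)[OF HL] finite_B Z_props(2)[OF HL] zero])
  show "a \<oplus>\<^bsub>obj R B\<^esub> b \<in> I" if "a \<in> I" "b \<in> I" for a b using that by (rule add)
  fix u assume "u \<in> pts (embed Tuple (Z H))"
  then obtain x where x: "x \<in> pts (Z H)" and u: "u = Tuple x" by auto
  have xf: "x \<in> fibre_power G m L H" using x by (simp add: pts_Z_gset)
  have one: "1 \<in> {1..m}" using m by simp
  obtain a where a: "a \<in> carrier G" "x 1 = a <# H"
    using fibre_powerD(2)[OF xf one] by (auto simp: LCOSETS_def)
  \<comment> \<open>Multiplication by a^-1 turns the first entry aH into H, which puts the tuple
    over the coset L.\<close>
  have \<kappa>: "(inv a, id) \<in> carrier P" using a by (simp add: sym_group_carrier permutes_id)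
  define y where "y = act (Z H) (inv a, id) x"
  have y: "y \<in> pts (Z H)"
    unfolding y_def by (rule finite_gsetD(4)[OF finite_gset_Z_gset[OF fin HL(1) L] \<kappa> x])
  then have yf: "y \<in> fibre_power G m L H" and nd: "y \<notin> diagonal G m H" by (auto simp: pts_Z_gset)
  have act_u: "act (embed Tuple (Z H)) (inv a, id) u = Tuple y"
    using x by (simp add: u y_def act_embed inj_on_def)
  have "y 1 = inv a <# x 1" using one by (simp add: y_def act_Z_gset[OF x permutes_id])
  also have "\<dots> = H"
    using a subgroup.subset[OF HL(1)] by (simp add: lcos_m_assoc lcos_mult_one)
  finally have "y 1 = H" .
  then have y1: "y 1 <#> L = L"
    using subset_set_mult_subgroup[OF L HL(2)] subgroup.one_closed[OF HL(1)] by blast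
  interpret coset_tuple G H L m y
  proof (intro coset_tuple.intro coset_tuple_axioms.intro)
    show "group G" by (rule is_group)
    show "subgroup H G" by (rule HL(1))
    show "subgroup L G" by (rule L)
    show "1 \<le> m" by (rule m)
    fix k assume k: "k \<in> {1..m}"
    show yk: "y k \<in> lcosets H" by (rule fibre_powerD(2)[OF yf k])
    have "y k \<subseteq> carrier G" using lcosets_subset_PowG[OF HL(1)] yk by blast
    \<comment> \<open>An entry C lies in C L, and C L = H L = L by the fibre condition; so all
      entries lie in L.\<close>
    then have "y k \<subseteq> y k <#> L"
      using subgroup.one_closed[OF L] by (force simp: set_mult_def)
    also have "y k <#> L = L" using fibre_powerD(3)[OF yf k one] y1 by simp
    finally show "y k \<subseteq> L" .
  qed
  have "\<exists>Y h. \<exists>w\<in>pts Y. finite_gset P Y \<and> gmap P Y B h \<and>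
      h w = Z_map H (Tuple y) \<and> tr R Y B h ` carrier (obj R Y) \<subseteq> I \<and>
      (\<forall>\<gamma>\<in>carrier P. act (embed Tuple (Z H)) \<gamma> (Tuple y) = Tuple y \<longrightarrow> act Y \<gamma> w = w)"
  proof (cases transitive)
    case False
    then obtain i j \<sigma>0 where ij: "i + j = m" "0 < i" "0 < j" and \<sigma>0: "\<sigma>0 permutes {1..m}"
      and T: "\<And>g \<sigma>. (g, \<sigma>) \<in> T \<Longrightarrow> (g, inv' \<sigma>0 \<circ> \<sigma> \<circ> \<sigma>0) \<in> L \<times> young i j"
      by (rule young_case) blast
    show ?thesis
    proof (rule fixes_orbit_witness[OF HL _ young_subset(1)[OF ij(1)] \<sigma>0 y y1 T[unfolded T_def]])
      show "subgroup (L \<times> young i j) P" using subgroup_young[OF L, of i j] ij by simp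
      show "orbit_tr G m R L (L \<times> young i j) ` carrier (orbit_level G m R (L \<times> young i j)) \<subseteq> I"
        using young_image_subset_I_Tr[OF ij] I_Tr by blast
    qed
  next
    case True
    have nonconst: "\<exists>k\<in>{1..m}. y k \<noteq> y 1"
    proof (rule ccontr)
      assume c: "\<not> (\<exists>k\<in>{1..m}. y k \<noteq> y 1)"
      have eq: "y = (\<lambda>k\<in>{1..m}. y 1)"
      proof (rule extensionalityI[OF fibre_powerD(1)[OF yf] restrict_extensional])
        fix k assume k: "k \<in> {1..m}"
        show "y k = (\<lambda>k\<in>{1..m}. y 1) k" unfolding restrict_apply'[OF k] using c k by blast
      qed
      have "(\<lambda>k\<in>{1..m}. y 1) \<in> diagonal G m H"
        unfolding diagonal_def by (rule imageI[OF fibre_powerD(2)[OF yf one]])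
      with nd show False unfolding eq[symmetric] ..
    qed
    obtain K where K: "subgroup K G" "K \<subset> S"
      and wr: "\<forall>e n. n = card (cosets_in G S K) \<longrightarrow> bij_betw e {1..n} (cosets_in G S K) \<longrightarrow>
      n \<noteq> 1 \<and> (\<exists>q \<sigma>0. m = n * q \<and> \<sigma>0 permutes {1..m} \<and>
        (\<forall>g \<sigma>. (g, \<sigma>) \<in> T \<longrightarrow> (g, inv' \<sigma>0 \<circ> \<sigma> \<circ> \<sigma>0) \<in> wreath_preimage q n (graph_subgroup G n e S)))"
      by (rule wreath_case[OF True fin nonconst])
    define n where "n = card (cosets_in G S K)"
    have eSK: "bij_betw (e S K) {1..n} (cosets_in G S K)"
      unfolding n_def by (rule e[OF subgroup_S K S_subset])
    obtain q \<sigma>0 where n: "n \<noteq> 1" and mnq: "m = n * q" and \<sigma>0: "\<sigma>0 permutes {1..m}"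
      and T: "\<And>g \<sigma>. (g, \<sigma>) \<in> T \<Longrightarrow>
        (g, inv' \<sigma>0 \<circ> \<sigma> \<circ> \<sigma>0) \<in> wreath_preimage q n (graph_subgroup G n (e S K) S)"
      using wr[rule_format, OF n_def eSK] by blast
    note ws = wreath_subset[OF subgroup_S S_subset subgroup.subset[OF K(1)] eSK mnq]
    show ?thesis
      by (rule fixes_orbit_witness[OF HL ws(2,1) \<sigma>0 y y1 T[unfolded T_def]
            wreath[OF mnq subgroup_S K S_subset n_def[symmetric] n]])
  qed
  then show "\<exists>\<kappa>\<in>carrier P. \<exists>Y h. \<exists>w\<in>pts Y. finite_gset P Y \<and> gmap P Y B h \<and>
      h w = Z_map H (act (embed Tuple (Z H)) \<kappa> u) \<and> tr R Y B h ` carrier (obj R Y) \<subseteq> I \<and>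
      (\<forall>\<gamma>\<in>carrier P. act (embed Tuple (Z H)) \<gamma> (act (embed Tuple (Z H)) \<kappa> u)
        = act (embed Tuple (Z H)) \<kappa> u \<longrightarrow> act Y \<gamma> w = w)"
    unfolding act_u[symmetric] by (rule bexI[OF _ \<kappa>])
qed

text \<open>The fixed point is the tuple x that runs through S/K in the order e, each coset repeated
  q times. It lies over L because its entries lie in L, and off the diagonal because n \<ge> 2. Its
  entries are cosets of K, so the comparison is with Z^{L,K}.\<close>

lemma wreath_image_subset_Z_image:
  assumes S: "subgroup S G" "S \<subseteq> L" and K: "subgroup K G" "K \<subseteq> S"
    and e: "bij_betw e {1..n} (cosets_in G S K)" and mnq: "m = n * q" and n: "n \<noteq> 1"
  shows "orbit_tr G m R L (wreath_preimage q n (graph_subgroup G n e S))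
        ` carrier (orbit_level G m R (wreath_preimage q n (graph_subgroup G n e S)))
    \<subseteq> tr_to_base G R L Tuple (Z K) (fibre_proj G L) ` carrier (obj R (embed Tuple (Z K)))"
proof -
  define \<Lambda> where "\<Lambda> = wreath_preimage q n (graph_subgroup G n e S)"
  have Kc: "K \<subseteq> carrier G" by (rule subgroup.subset[OF K(1)])
  have \<Lambda>: "\<Lambda> \<subseteq> L \<times> carrier (sym_group m)" "subgroup \<Lambda> P"
    unfolding \<Lambda>_def by (rule wreath_subset[OF S Kc e mnq])+
  have \<Lambda>_eq: "\<Lambda> = tuple_stabilizer S m (\<lambda>g C. g <# C) (\<lambda>k. e (block q k))"
    using mnq by (simp add: \<Lambda>_def wreath_preimage_eq_tuple_stabilizer[OF S(1) Kc e] mult.commute)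
  have ne: "\<Lambda> \<noteq> {}" using subgroup.one_closed[OF \<Lambda>(2)] by blast
  have \<Lambda>c: "\<Lambda> \<subseteq> carrier P" by (rule subgroup.subset[OF \<Lambda>(2)])
  have KL: "K \<subseteq> L" using K S by blast
  have m': "{1..m} = {1..q * n}" using mnq by (simp add: mult.commute)
  have one: "1 \<in> {1..m}" using m by simp
  \<comment> \<open>m \<ge> 1 excludes q = 0 and n = 0.\<close>
  have q: "q \<ge> 1" and n2: "n \<ge> 2" using m mnq n by (auto simp: Suc_le_eq intro: Nat.gr0I)
  define x where "x = (\<lambda>k\<in>{1..m}. e (block q k))"
  have ec: "e (block q k) \<in> cosets_in G S K" if "k \<in> {1..m}" for k
    using e block_offset_bounds(1) that unfolding m' by (auto simp: bij_betw_def)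
  have eL: "e (block q k) <#> L = L" if k: "k \<in> {1..m}" for k
  proof -
    obtain s where s: "s \<in> S" "e (block q k) = s <# K" using ec[OF k] by (auto simp: cosets_in_eq)
    show ?thesis
    proof (rule subset_set_mult_subgroup[OF L])
      show "e (block q k) \<subseteq> L"
        using K(2) S(2) subgroup.m_closed[OF S(1) s(1)] unfolding s(2) l_coset_def by blast
      show "e (block q k) \<noteq> {}"
        using s lcos_self[OF subgroup.mem_carrier[OF S(1) s(1)] K(1)] by blast
    qed
  qed
  have "x \<in> fibre_power G m L K"
  proof -
    have "x \<in> {1..m} \<rightarrow>\<^sub>E lcosets K"
      using ec subgroup.mem_carrier[OF S(1)] by (fastforce simp: x_def cosets_in_eq LCOSETS_def)
    moreover have "x k <#> L = L" if "k \<in> {1..m}" for k using eL[OF that] that by (simp add: x_def)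
    ultimately show ?thesis unfolding fibre_power_def by blast
  qed
  moreover have "x \<notin> diagonal G m K"
  proof
    assume "x \<in> diagonal G m K"
    then obtain C where C: "x = (\<lambda>i\<in>{1..m}. C)" by (auto simp: diagonal_def)
    have b1: "1 \<in> {1..n}" and b2: "2 \<in> {1..n}" and r1: "1 \<in> {1..q}" using n2 q by auto
    \<comment> \<open>Positions 1 and q + 1 open the blocks 1 and 2, which carry different
      cosets.\<close>
    have "x ((1 - 1) * q + 1) = e 1" "x ((2 - 1) * q + 1) = e 2"
      using block_offset_of[OF b1 r1] block_offset_of[OF b2 r1] unfolding x_def m' by simp_all
    moreover have "(1 - 1) * q + 1 \<in> {1..m}" "(2 - 1) * q + 1 \<in> {1..m}"
      using block_offset_of(1)[OF b1 r1] block_offset_of(1)[OF b2 r1] unfolding m' by blast+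
    ultimately have "e 1 = e 2" unfolding C by simp
    then show False using e b1 b2 by (auto simp: bij_betw_def dest: inj_onD)
  qed
  ultimately have x: "x \<in> pts (Z K)" by (simp add: pts_Z_gset)
  have \<Lambda>_pts: "\<Lambda> \<in> pts (homog P \<Lambda>)"
    using R.lcos_mult_one[OF \<Lambda>c] R.one_closed unfolding R.pts_homog by (metis imageI)
  have injs: "inj_on GSCoset A" "inj_on Tuple A'" for A A' by (simp_all add: inj_on_def)
  have act_\<Lambda>: "act (orbit_gset \<Lambda>) \<gamma> (GSCoset \<Lambda>) = GSCoset (\<gamma> <#\<^bsub>P\<^esub> \<Lambda>)" for \<gamma>
    using \<Lambda>_pts by (simp add: act_embed[OF injs(1)] R.act_homog)
  have "tr R (orbit_gset \<Lambda>) B (orbit_map \<Lambda>) ` carrier (obj R (orbit_gset \<Lambda>))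
    \<subseteq> tr R (embed Tuple (Z K)) B (Z_map K) ` carrier (obj R (embed Tuple (Z K)))"
  proof (rule R.tr_orbit_subset[OF orbit_gset_props(1)[OF \<Lambda>(1) ne] Z_props(1)[OF K(1) KL] finite_B
        orbit_gset_props(2)[OF \<Lambda>(1) ne] Z_props(2)[OF K(1) KL]])
    show "GSCoset \<Lambda> \<in> pts (orbit_gset \<Lambda>)" using \<Lambda>_pts by simp
    show "pts (orbit_gset \<Lambda>) = (\<lambda>\<gamma>. act (orbit_gset \<Lambda>) \<gamma> (GSCoset \<Lambda>)) ` carrier P"
      by (simp add: act_\<Lambda> R.pts_homog image_image)
    show "Tuple x \<in> pts (embed Tuple (Z K))" using x by simp
    have "coset_proj G L \<Lambda> = L"
      using coset_proj_l_coset[OF R.one_closed \<Lambda>(1) ne L] R.lcos_mult_one[OF \<Lambda>c]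
        lcos_mult_one[OF subgroup.subset[OF L]] by simp
    moreover have "fibre_proj G L x = L" using eL[OF one] one by (simp add: fibre_proj_def x_def)
    ultimately show "Z_map K (Tuple x) = orbit_map \<Lambda> (GSCoset \<Lambda>)"
      by (simp add: embed_map_apply[OF injs(1) \<Lambda>_pts] embed_map_apply[OF injs(2) x])
    fix \<gamma> assume \<gamma>: "\<gamma> \<in> carrier P" and "act (orbit_gset \<Lambda>) \<gamma> (GSCoset \<Lambda>) = GSCoset \<Lambda>"
    then have "\<gamma> <#\<^bsub>P\<^esub> \<Lambda> = \<Lambda>" by (simp add: act_\<Lambda>)
    \<comment> \<open>The base point of the orbit is the coset \<Lambda>, so its stabilizer is
      \<Lambda> itself, which is known to be the stabilizer of the repeated tuple.\<close>
    then have "\<gamma> \<in> \<Lambda>" using R.lcos_self[OF \<gamma> \<Lambda>(2)] by simp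
    then obtain g \<sigma> where g\<sigma>: "\<gamma> = (g, \<sigma>)" and \<sigma>: "\<sigma> permutes {1..m}"
      and eq: "\<And>k. k \<in> {1..m} \<Longrightarrow> e (block q (\<sigma> k)) = g <# e (block q k)"
      unfolding \<Lambda>_eq by (cases \<gamma>) (auto simp: mem_tuple_stabilizer)
    have "x (\<sigma> k) = g <# x k" if k: "k \<in> {1..m}" for k
    proof -
      have "\<sigma> k \<in> {1..m}" using k permutes_in_image[OF \<sigma>] by blast
      then show ?thesis using eq[OF k] k by (simp add: x_def)
    qed
    then show "act (embed Tuple (Z K)) \<gamma> (Tuple x) = Tuple x"
      using act_Z_gset_eq_iff[OF x \<sigma>] by (simp add: act_embed[OF injs(2) x] g\<sigma>)
  qed
  then show ?thesis
    unfolding \<Lambda>_def[symmetric] by (simp add: orbit_tr_eq orbit_level_def tr_to_base_def)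
qed

lemma wreath_image_subset_carrier:
  assumes S: "subgroup S G" "S \<subseteq> L" and K: "K \<subseteq> carrier G"
    and e: "bij_betw e {1..n} (cosets_in G S K)" and mnq: "m = n * q"
  shows "orbit_tr G m R L (wreath_preimage q n (graph_subgroup G n e S))
        ` carrier (orbit_level G m R (wreath_preimage q n (graph_subgroup G n e S)))
    \<subseteq> carrier (obj R B)"
proof -
  note ws = wreath_subset[OF assms]
  have ne: "wreath_preimage q n (graph_subgroup G n e S) \<noteq> {}"
    using subgroup.one_closed[OF ws(2)] by blast
  show ?thesis
    unfolding orbit_tr_eq orbit_level_def
    using R.tr_closed[OF orbit_gset_props(1)[OF ws(1) ne] finite_B orbit_gset_props(2)[OF ws(1) ne]]
    by blast
qed

end

theorem proposition3p21:
  fixes G :: "('g, 'c) monoid_scheme"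
    and m :: nat
    and R :: "('g \<times> (nat \<Rightarrow> nat), 'g point, 'r) mackey"
    and L :: "'g set"
    and e :: "'g set \<Rightarrow> 'g set \<Rightarrow> nat \<Rightarrow> 'g set"
  assumes "group G"
    and "finite (carrier G)"
    and "m \<ge> 1"
    and "green_functor (G \<times>\<times> sym_group m) R"
    and "subgroup L G"
    and ordering: "\<And>S K. \<lbrakk>subgroup S G; subgroup K G; K \<subset> S; S \<subseteq> L\<rbrakk>
          \<Longrightarrow> bij_betw (e S K) {1..card (cosets_in G S K)} (cosets_in G S K)"
  shows "J G m R L =
    Idl\<^bsub>obj (induced R) (base G L)\<^esub>
      (I_Tr G m R L \<union>
       \<Union> {orbit_tr G m R L (wreath_preimage q n (graph_subgroup G n (e S K) S))
             ` carrier (orbit_level G m R (wreath_preimage q n (graph_subgroup G n (e S K) S)))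
           | n q S K. m = n * q \<and> subgroup S G \<and> subgroup K G \<and> K \<subset> S \<and> S \<subseteq> L
               \<and> card (cosets_in G S K) = n \<and> n \<noteq> 1})"
proof -
  interpret green_functor "G \<times>\<times> sym_group m" R by fact
  interpret product_mackey G m R L
    by (intro product_mackey.intro product_mackey_axioms.intro assms mackey_functor_axioms)
  interpret A: cring "obj R B" by (rule obj_cring[OF finite_B])
  have obj: "obj (induced R) (base G L) = obj R B" by (simp add: induced_def)
  define ZU where "ZU = (\<Union>H\<in>{H. subgroup H G \<and> H \<subseteq> L}.
    tr_to_base G R L Tuple (Z H) (fibre_proj G L) ` carrier (obj R (embed Tuple (Z H))))"
  define WU where "WU = \<Union> {orbit_tr G m R L (wreath_preimage q n (graph_subgroup G n (e S K) S))
             ` carrier (orbit_level G m R (wreath_preimage q n (graph_subgroup G n (e S K) S)))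
           | n q S K. m = n * q \<and> subgroup S G \<and> subgroup K G \<and> K \<subset> S \<and> S \<subseteq> L
               \<and> card (cosets_in G S K) = n \<and> n \<noteq> 1}"
  have WU_I: "orbit_tr G m R L (wreath_preimage q n (graph_subgroup G n (e S K) S))
        ` carrier (orbit_level G m R (wreath_preimage q n (graph_subgroup G n (e S K) S))) \<subseteq> WU"
    if "m = n * q" "subgroup S G" "subgroup K G" "K \<subset> S" "S \<subseteq> L" "card (cosets_in G S K) = n" "n \<noteq> 1"
    for n q S K
    unfolding WU_def using that by (intro Union_upper) blast
  have WU_E: "WU \<subseteq> X"
    if "\<And>n q S K. \<lbrakk>m = n * q; subgroup S G; subgroup K G; K \<subset> S; S \<subseteq> L;
        card (cosets_in G S K) = n; n \<noteq> 1\<rbrakk> \<Longrightarrow>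
      orbit_tr G m R L (wreath_preimage q n (graph_subgroup G n (e S K) S))
        ` carrier (orbit_level G m R (wreath_preimage q n (graph_subgroup G n (e S K) S))) \<subseteq> X" for X
    unfolding WU_def by (rule Union_least) (use that in blast)
  have ZUc: "ZU \<subseteq> carrier (obj R B)"
    unfolding ZU_def tr_to_base_def using tr_closed[OF Z_props(1) finite_B Z_props(2)] by blast
  have WUc: "WU \<subseteq> carrier (obj R B)"
  proof (rule WU_E)
    fix n q S K
    assume *: "m = n * q" "subgroup S G" "subgroup K G" "K \<subset> S" "S \<subseteq> L"
      "card (cosets_in G S K) = n" "n \<noteq> 1"
    have "bij_betw (e S K) {1..n} (cosets_in G S K)" using ordering[OF *(2-5)] *(6) by simp
    then show "orbit_tr G m R L (wreath_preimage q n (graph_subgroup G n (e S K) S))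
        ` carrier (orbit_level G m R (wreath_preimage q n (graph_subgroup G n (e S K) S)))
      \<subseteq> carrier (obj R B)"
      by (rule wreath_image_subset_carrier[OF *(2,5) subgroup.subset[OF *(3)] _ *(1)])
  qed
  note IT = I_Tr_subset_carrier
  have "Idl\<^bsub>obj R B\<^esub> (I_Tr G m R L \<union> ZU) = Idl\<^bsub>obj R B\<^esub> (I_Tr G m R L \<union> WU)"
  proof
    let ?I = "Idl\<^bsub>obj R B\<^esub> (I_Tr G m R L \<union> WU)"
    interpret I: ideal ?I "obj R B" by (rule A.genideal_ideal) (use IT WUc in blast)
    have sub: "I_Tr G m R L \<union> WU \<subseteq> ?I" by (rule A.genideal_self) (use IT WUc in blast)
    \<comment> \<open>The ideal enters as the set I of the orbit argument, through its zero and its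
      closure under sums.\<close>
    have "ZU \<subseteq> ?I"
      unfolding ZU_def
    proof (rule UN_least)
      fix H assume "H \<in> {H. subgroup H G \<and> H \<subseteq> L}"
      then have H: "subgroup H G" "H \<subseteq> L" by auto
      show "tr_to_base G R L Tuple (Z H) (fibre_proj G L) ` carrier (obj R (embed Tuple (Z H))) \<subseteq> ?I"
      proof (rule Z_image_subset[where e = e, OF H I.zero_closed I.a_closed _ ordering])
        show "I_Tr G m R L \<subseteq> ?I" using sub by blast
        show "orbit_tr G m R L (wreath_preimage q n (graph_subgroup G n (e S K) S))
            ` carrier (orbit_level G m R (wreath_preimage q n (graph_subgroup G n (e S K) S))) \<subseteq> ?I"
          if "m = n * q" "subgroup S G" "subgroup K G" "K \<subset> S" "S \<subseteq> L"
            "card (cosets_in G S K) = n" "n \<noteq> 1" for n q S K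
          using WU_I[OF that] sub by blast
      qed
    qed
    with sub show "Idl\<^bsub>obj R B\<^esub> (I_Tr G m R L \<union> ZU) \<subseteq> ?I"
      by (intro A.genideal_minimal I.is_ideal) blast
  next
    let ?I = "Idl\<^bsub>obj R B\<^esub> (I_Tr G m R L \<union> ZU)"
    have I: "ideal ?I (obj R B)" by (rule A.genideal_ideal) (use IT ZUc in blast)
    have sub: "I_Tr G m R L \<union> ZU \<subseteq> ?I" by (rule A.genideal_self) (use IT ZUc in blast)
    \<comment> \<open>In this direction the inclusion holds before passing to ideals: each wreath
      image sits inside the image of the transfer from Z^{L,K}.\<close>
    have "WU \<subseteq> ZU"
    proof (rule WU_E)
      fix n q S K
      assume *: "m = n * q" "subgroup S G" "subgroup K G" "K \<subset> S" "S \<subseteq> L"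
        "card (cosets_in G S K) = n" "n \<noteq> 1"
      have "bij_betw (e S K) {1..n} (cosets_in G S K)" using ordering[OF *(2-5)] *(6) by simp
      from wreath_image_subset_Z_image[OF *(2,5,3) _ this *(1,7)] *(3,4,5)
      show "orbit_tr G m R L (wreath_preimage q n (graph_subgroup G n (e S K) S))
        ` carrier (orbit_level G m R (wreath_preimage q n (graph_subgroup G n (e S K) S))) \<subseteq> ZU"
        unfolding ZU_def by blast
    qed
    with sub show "Idl\<^bsub>obj R B\<^esub> (I_Tr G m R L \<union> WU) \<subseteq> ?I"
      by (intro A.genideal_minimal I) blast
  qed
  then show ?thesis unfolding J_def obj ZU_def WU_def .
qed

end
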